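(* Let $(\Omega,\mathcal F,\mathbb P)$ be a probability space and $\sigma:\Omega\to\Omega$ an invertible, ergodic, $\mathbb P$-preserving transformation. Let $(\mathcal B_w,\|\cdot\|_w)$, $(\mathcal B_s,\|\cdot\|_s)$, $(\mathcal B_{ss},\|\cdot\|_{ss})$ be Banach spaces such that $\mathcal B_{ss}$ is embedded in $\mathcal B_s$, $\mathcal B_s$ is embedded in $\mathcal B_w$, $\|\cdot\|_w\le\|\cdot\|_s$ on $\mathcal B_s$ and $\|\cdot\|_s\le\|\cdot\|_{ss}$ on $\mathcal B_{ss}$. Let $\psi$ be a nonzero bounded functional on $\mathcal B_s$ admitting a bounded extension to $\mathcal B_w$; denote its restriction to $\mathcal B_{ss}$ and its extension to $\mathcal B_w$ again by $\psi$. Set $V_{ss}:=\{h\in\mathcal B_{ss}:\psi(h)=0\}$, and let $V_s$ and $V_w$ denote the images of $V_{ss}$ under the natural injections $\mathcal B_{ss}\hookrightarrow\mathcal B_s$ and $\mathcal B_{ss}\hookrightarrow\mathcal B_w$, respectively. Let $I\subset(-1,1)$ be an interval containing $0$ and let $(\mathcal L_{\omega,\epsilon})_{\omega\in\Omega,\epsilon\in I}$ be a family of operators, each bounded on each of the three spaces, with $\mathcal L_{\omega,\epsilon}^*\psi=\psi$ for all $\omega\in\Omega$, $\epsilon\in I$. Write $\mathcal L_\omega:=\mathcal L_{\omega,0}$ and suppose that $\omega\mapsto\mathcal L_\omega h$ is measurable for each $h\in\mathcal B_w$. Let $(\epsilon_k)_{k\in\mathbb N}$ be a sequence in $I\setminus\{0\}$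 with $\lim_{k\to\infty}\epsilon_k=0$, set $\epsilon_0:=0$, and write $\mathcal L_{\omega,k}:=\mathcal L_{\omega,\epsilon_k}$ for $k\in\mathbb N_0$. Assume that there exist a $\sigma$-invariant set $\Omega'\subset\Omega$ of full measure and $C\in\mathcal K$ such that: (1) for $\omega\in\Omega'$ and $k\in\mathbb N_0$ there exists $h_{\omega,k}\in\mathcal B_{ss}$ such that $\mathcal L_{\omega,k}h_{\omega,k}=h_{\sigma\omega,k}$, $\psi(h_{\omega,k})=1$ and $\|h_{\omega,k}\|_{ss}\le C(\omega)$; moreover, $\omega\mapsto h_{\omega,0}$ is measurable; (2) for $\omega\in\Omega'$, $i\in\{w,s\}$, $h\in\mathcal B_i$ and $n\in\mathbb N$, $\|\mathcal L^n_{\sigma^{-n}\omega}h\|_i\le C(\omega)\|h\|_i$; (3) there exists $\lambda>0$ such that for $\omega\in\Omega'$, $n\in\mathbb N$, $i\in\{w,s\}$ and $h\in V_i$, $\|\mathcal L^n_\omega h\|_i\le C(\omega)e^{-\lambda n}\|h\|_i$; (4) for $\omega\in\Omega'$ and $k\in\mathbb N$, $\|(\mathcal L_{\omega,k}-\mathcal L_\omega)h\|_w\le C(\omega)|\epsilon_k|\,\|h\|_s$ for all $h\in\mathcal B_s$, and $\|(\mathcal L_{\omega,k}-\mathcal L_\omega)h\|_s\le C(\omega)|\epsilon_k|\,\|h\|_{ss}$ for all $h\in\mathcal B_{ss}$; (5) for $\omega\in\Omega'$ there exists a bounded operator $\hat{\mathcal L}_\omega:\mathcal B_{ss}\to V_w$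 such that $$\Big\|\frac1{\epsilon_k}(\mathcal L_{\omega,k}-\mathcal L_\omega)h-\hat{\mathcal L}_\omega h\Big\|_w\le C(\omega)|\epsilon_k|\,\|h\|_{ss}$$ for $\omega\in\Omega'$, $h\in\mathcal B_{ss}$ and $k\in\mathbb N$; moreover, $\omega\mapsto\hat{\mathcal L}_\omega h$ is measurable for each $h\in\mathcal B_{ss}$. Then there exist a measurable map $\omega\in\Omega\mapsto\hat h_\omega\in V_w$, $K\in\mathcal K$ and $r>0$ such that $$\Big\|\frac1{\epsilon_k}(h_{\omega,k}-h_\omega)-\hat h_\omega\Big\|_w\le K(\omega)|\epsilon_k|^r$$ for $\mathbb P$-a.e. $\omega\in\Omega$ and all $k\in\mathbb N$, where $h_\omega:=h_{\omega,0}$. In addition, $$\hat h_\omega=\sum_{n=0}^\infty\mathcal L^n_{\sigma^{-n}\omega}\hat{\mathcal L}_{\sigma^{-(n+1)}\omega}h_{\sigma^{-(n+1)}\omega}\quad\text{for }\mathbb P\text{-a.e. }\omega\in\Omega.$$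
   Context: A random variable $K:\Omega\to(0,\infty)$ is called tempered if $\lim_{n\to\pm\infty}\frac1n\log K(\sigma^n\omega)=0$ for $\mathbb P$-a.e. $\omega\in\Omega$; $\mathcal K$ denotes the set of all tempered random variables. For $n\in\mathbb N$, $\mathcal L^n_{\omega,\epsilon}:=\mathcal L_{\sigma^{n-1}\omega,\epsilon}\circ\cdots\circ\mathcal L_{\sigma\omega,\epsilon}\circ\mathcal L_{\omega,\epsilon}$, $\mathcal L^n_\omega:=\mathcal L^n_{\omega,0}$ and $\mathcal L^0_\omega:=\mathrm{Id}$. The condition $\mathcal L_{\omega,\epsilon}^*\psi=\psi$ means $\psi(\mathcal L_{\omega,\epsilon}h)=\psi(h)$ for all $h$.
   Formalization: The response ĥ_ω is claimed to lie in the closure of V_w in B_w, because with the non-closed image V_w the claim can fail; measurability of Banach-valued maps is understood as strong measurability (Borel with separable range). *)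

theory Defs
  imports "HOL-Probability.Probability"
begin

definition mp_automorphism :: "'a measure \<Rightarrow> ('a \<Rightarrow> 'a) \<Rightarrow> bool" where
  "mp_automorphism M \<sigma> \<longleftrightarrow>
     bij_betw \<sigma> (space M) (space M) \<and> \<sigma> \<in> measurable M M \<and>
     the_inv_into (space M) \<sigma> \<in> measurable M M \<and> distr M M \<sigma> = M"

definition ergodic :: "'a measure \<Rightarrow> ('a \<Rightarrow> 'a) \<Rightarrow> bool" where
  "ergodic M \<sigma> \<longleftrightarrow>
     (\<forall>A\<in>sets M. \<sigma> -` A \<inter> space M = A \<longrightarrow> measure M A = 0 \<or> measure M A = 1)"

definition zpow :: "'a measure \<Rightarrow> ('a \<Rightarrow> 'a) \<Rightarrow> int \<Rightarrow> 'a \<Rightarrow> 'a" where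
  "zpow M \<sigma> n = (if n \<ge> 0 then \<sigma> ^^ nat n else the_inv_into (space M) \<sigma> ^^ nat (- n))"

definition tempered :: "'a measure \<Rightarrow> ('a \<Rightarrow> 'a) \<Rightarrow> ('a \<Rightarrow> real) \<Rightarrow> bool" where
  "tempered M \<sigma> K \<longleftrightarrow>
     K \<in> borel_measurable M \<and> (\<forall>\<omega>\<in>space M. K \<omega> > 0) \<and>
     (AE \<omega> in M.
        ((\<lambda>n::int. 1 / of_int n * ln (K (zpow M \<sigma> n \<omega>))) \<longlongrightarrow> 0) at_top \<and>
        ((\<lambda>n::int. 1 / of_int n * ln (K (zpow M \<sigma> n \<omega>))) \<longlongrightarrow> 0) at_bot)"

(* Measurability of maps into Banach spaces that need not be separable: Borel measurable with
   separable range, i.e. a pointwise limit of simple functions. In a separable space this is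
   plain Borel measurability. *)
definition strongly_measurable :: "'a measure \<Rightarrow> ('a \<Rightarrow> 'b::real_normed_vector) \<Rightarrow> bool" where
  "strongly_measurable M f \<longleftrightarrow>
     f \<in> borel_measurable M \<and> (\<exists>D. countable D \<and> f ` space M \<subseteq> closure D)"

primrec cocycle ::
  "('a \<Rightarrow> 'a) \<Rightarrow> ('a \<Rightarrow> 'b::real_normed_vector \<Rightarrow>\<^sub>L 'b) \<Rightarrow> nat \<Rightarrow> 'a \<Rightarrow> 'b \<Rightarrow>\<^sub>L 'b" where
  "cocycle \<sigma> L 0 \<omega> = id_blinfun"
| "cocycle \<sigma> L (Suc n) \<omega> = L ((\<sigma> ^^ n) \<omega>) o\<^sub>L cocycle \<sigma> L n \<omega>"

(* A bounded embedding of norm at most 1. The chain of spaces is modelled by three Banach types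
   and two such maps, jss into the strong space and js into the weak space; an operator acting
   on all three spaces is a triple of bounded operators intertwined by js and jss. *)
definition contractive_embedding :: "('b::real_normed_vector \<Rightarrow>\<^sub>L 'c::real_normed_vector) \<Rightarrow> bool" where
  "contractive_embedding j \<longleftrightarrow> inj (blinfun_apply j) \<and> (\<forall>x. norm (j x) \<le> norm x)"

(* The type 'k of values of psi is the scalar field. Linearity is over the reals; this includes
   complex Banach spaces (with 'k = complex), complex-linear maps being real-linear. *)
definition Vss ::
  "('ss::real_normed_vector \<Rightarrow>\<^sub>L 's::real_normed_vector) \<Rightarrow> ('s \<Rightarrow>\<^sub>L 'k::real_normed_field) \<Rightarrow> 'ss set" where
  "Vss jss \<psi> = {h. \<psi> (jss h) = 0}"

definition Vs ::
  "('ss::real_normed_vector \<Rightarrow>\<^sub>L 's::real_normed_vector) \<Rightarrow> ('s \<Rightarrow>\<^sub>L 'k::real_normed_field) \<Rightarrow> 's set" where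
  "Vs jss \<psi> = jss ` Vss jss \<psi>"

(* Vw is in general not closed in the weak space, so the sum of a convergent series with terms
   in Vw lies in closure (Vw js jss psi) but need not lie in Vw itself. *)
definition Vw ::
  "('s::real_normed_vector \<Rightarrow>\<^sub>L 'w::real_normed_vector) \<Rightarrow> ('ss::real_normed_vector \<Rightarrow>\<^sub>L 's) \<Rightarrow>
   ('s \<Rightarrow>\<^sub>L 'k::real_normed_field) \<Rightarrow> 'w set" where
  "Vw js jss \<psi> = (\<lambda>h. js (jss h)) ` Vss jss \<psi>"

end

theory Submission
  imports Defs
begin

text \<open>
  Equivariance of \<open>h \<cdot> k\<close> under the perturbed and of \<open>h \<cdot> 0\<close> under the unperturbed operators gives,
  writing \<open>L\<^sub>k\<close> for the operator with parameter \<open>\<epsilon> k\<close> and \<open>d = h k - h 0\<close>,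
  \<open>d (\<sigma> \<omega>) = L\<^sub>0 (d \<omega>) + (L\<^sub>k - L\<^sub>0) (h \<omega> k)\<close>.
  Iterated along the backward orbit, this writes \<open>d \<omega>\<close> as the sum over \<open>n\<close> of the \<open>n\<close>-step
  unperturbed transport of the forcing terms \<open>(L\<^sub>k - L\<^sub>0) (h k)\<close>, taken at the \<open>(n + 1)\<close>-st preimage
  of \<open>\<omega>\<close> (lemma \<open>telescoping_sums\<close>). The forcing comes from the smallest space and, since \<open>\<psi>\<close> is
  preserved, lies in its kernel, where the transport contracts exponentially.

  In the strong norm the forcing is of order \<open>\<epsilon> k\<close>, hence so is \<open>d\<close>. In the weak norm, the
  forcing divided by \<open>\<epsilon> k\<close> differs from \<open>Lhat (h 0)\<close> by
  \<open>(1 / \<epsilon> k) (L\<^sub>k - L\<^sub>0) d + ((1 / \<epsilon> k) (L\<^sub>k - L\<^sub>0) (h 0) - Lhat (h 0))\<close>,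
  where the first term is of order \<open>\<epsilon> k\<close> by the strong estimate of \<open>d\<close> and the second one by
  hypothesis. Summation over the orbit transfers this order to the difference between \<open>d / \<epsilon> k\<close> and
  the series defining \<open>hhat\<close>, so that the exponent \<open>r = 1\<close> is attained.

  The constants in these estimates depend on the point of the orbit. The lemma \<open>tempered_envelope\<close>
  replaces \<open>C\<close> by a larger tempered variable \<open>B\<close> that grows along orbits at an exponential rate
  \<open>\<delta>\<close> as small as desired. All series are then dominated by geometric ones
  (\<open>contraction_beats_growth\<close>, \<open>norm_sums_geometric\<close>), and the final constant is a multiple of
  \<open>B\<^sup>5\<close>, which is again tempered.

  Measurability of \<open>hhat\<close> rests on a Caratheodory argument for strongly measurable maps
  (\<open>strongly_measurable_caratheodory\<close>), since the Banach spaces need not be separable.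
\<close>

section \<open>Strong measurability\<close>

lemma strongly_measurable_compose:
  assumes f: "strongly_measurable N f" and g: "g \<in> measurable M N"
  shows "strongly_measurable M (\<lambda>\<omega>. f (g \<omega>))"
proof -
  obtain D where D: "countable D" "f ` space N \<subseteq> closure D"
    using f by (auto simp: strongly_measurable_def)
  have "f \<in> borel_measurable N"
    using f by (simp add: strongly_measurable_def)
  then have "(\<lambda>\<omega>. f (g \<omega>)) \<in> borel_measurable M"
    using g by (rule measurable_compose[rotated])
  moreover have "(\<lambda>\<omega>. f (g \<omega>)) ` space M \<subseteq> closure D"
    using D measurable_space[OF g] by auto
  ultimately show ?thesis
    using D by (auto simp: strongly_measurable_def)
qed

lemma strongly_measurable_continuous:
  assumes f: "strongly_measurable M f" and g: "continuous_on UNIV g"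
  shows "strongly_measurable M (\<lambda>\<omega>. g (f \<omega>))"
proof -
  obtain D where D: "countable D" "f ` space M \<subseteq> closure D"
    using f by (auto simp: strongly_measurable_def)
  have "f \<in> borel_measurable M"
    using f by (simp add: strongly_measurable_def)
  then have "(\<lambda>\<omega>. g (f \<omega>)) \<in> borel_measurable M"
    using borel_measurable_continuous_onI[OF g] by (rule measurable_compose)
  moreover have "g ` closure D \<subseteq> closure (g ` D)"
    by (rule image_closure_subset[OF continuous_on_subset[OF g] closed_closure closure_subset]) simp
  then have "(\<lambda>\<omega>. g (f \<omega>)) ` space M \<subseteq> closure (g ` D)"
    using D by auto
  ultimately show ?thesis
    using D by (auto simp: strongly_measurable_def intro!: exI[of _ "g ` D"])
qed

lemma strongly_measurable_LIMSEQ: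
  assumes f: "\<And>n. strongly_measurable M (f n)"
    and lim: "\<And>\<omega>. \<omega> \<in> space M \<Longrightarrow> (\<lambda>n. f n \<omega>) \<longlonglongrightarrow> g \<omega>"
  shows "strongly_measurable M g"
proof -
  have "\<exists>D. \<forall>n. countable (D n) \<and> f n ` space M \<subseteq> closure (D n)"
    by (rule choice) (use f in \<open>auto simp: strongly_measurable_def\<close>)
  then obtain D where D: "\<And>n. countable (D n)" "\<And>n. f n ` space M \<subseteq> closure (D n)"
    by auto
  have "g \<omega> \<in> closure (\<Union>n. D n)" if "\<omega> \<in> space M" for \<omega>
  proof (rule Lim_in_closed_set[OF closed_closure _ _ lim[OF that]])
    have "f n \<omega> \<in> closure (\<Union>n. D n)" for n
      using D(2)[of n] that closure_mono[of "D n" "\<Union>n. D n"] by auto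
    then show "\<forall>\<^sub>F n in sequentially. f n \<omega> \<in> closure (\<Union>n. D n)"
      by simp
  qed simp
  moreover have "g \<in> borel_measurable M"
    by (rule borel_measurable_LIMSEQ_metric[OF _ lim]) (use f in \<open>auto simp: strongly_measurable_def\<close>)
  ultimately show ?thesis
    using D(1) by (auto simp: strongly_measurable_def intro!: exI[of _ "\<Union>n. D n"])
qed

text \<open>The Caratheodory argument: approximate \<open>f\<close> by the point with the least index, in an
  enumeration of a countable set dense in its range, among those within distance \<open>1 / (m + 1)\<close>. With countably many values, the approximation may
  be inserted into \<open>F\<close> by splitting the space into countably many measurable pieces, and continuity
  of \<open>F \<omega>\<close> gives the limit.\<close>

lemma strongly_measurable_caratheodory:
  fixes F :: "'a \<Rightarrow> 'b::real_normed_vector \<Rightarrow> 'c::real_normed_vector"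
  assumes F: "\<And>x. strongly_measurable M (\<lambda>\<omega>. F \<omega> x)"
    and cont: "\<And>\<omega>. \<omega> \<in> space M \<Longrightarrow> continuous_on UNIV (F \<omega>)"
    and f: "strongly_measurable M f"
  shows "strongly_measurable M (\<lambda>\<omega>. F \<omega> (f \<omega>))"
proof (cases "space M = {}")
  case True
  then have "g \<in> borel_measurable M" for g :: "'a \<Rightarrow> 'c"
    by (simp add: measurable_def)
  then show ?thesis
    using True by (auto simp: strongly_measurable_def)
next
  case False
  obtain D where D: "countable D" "f ` space M \<subseteq> closure D"
    using f by (auto simp: strongly_measurable_def)
  with False have "D \<noteq> {}" by auto
  have f_meas: "f \<in> borel_measurable M"
    using f by (simp add: strongly_measurable_def)
  define d where "d = from_nat_into D"
  have range_d: "range d = D"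
    unfolding d_def using \<open>D \<noteq> {}\<close> D(1) by simp
  define i where "i m \<omega> = (LEAST j. dist (f \<omega>) (d j) < 1 / real (Suc m))" for m \<omega>
  have ex: "\<exists>j. dist (f \<omega>) (d j) < 1 / real (Suc m)" if "\<omega> \<in> space M" for \<omega> m
  proof -
    have "f \<omega> \<in> closure D" using D that by auto
    then obtain y where "y \<in> D" "dist y (f \<omega>) < 1 / real (Suc m)"
      unfolding closure_approachable by (meson of_nat_0_less_iff zero_less_Suc zero_less_divide_1_iff)
    then show ?thesis
      using range_d by (metis dist_commute imageE)
  qed
  have i_close: "dist (f \<omega>) (d (i m \<omega>)) < 1 / real (Suc m)" if "\<omega> \<in> space M" for \<omega> m
    unfolding i_def by (rule LeastI_ex[OF ex[OF that]])
  have dist_meas: "Measurable.pred M (\<lambda>\<omega>. dist (f \<omega>) (d j) < r)" for j r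
  proof -
    have "(\<lambda>\<omega>. dist (f \<omega>) (d j)) \<in> borel_measurable M"
      by (rule measurable_compose[OF f_meas])
        (auto intro!: borel_measurable_continuous_onI continuous_intros)
    then show ?thesis by measurable
  qed
  have i_meas: "i m \<in> measurable M (count_space UNIV)" for m
    unfolding i_def by (rule measurable_Least) (use dist_meas in \<open>auto simp: pred_def\<close>)
  show ?thesis
  proof (rule strongly_measurable_LIMSEQ[where f = "\<lambda>m \<omega>. F \<omega> (d (i m \<omega>))"])
    fix m
    have "\<exists>E. \<forall>j. countable (E j) \<and> (\<lambda>\<omega>. F \<omega> (d j)) ` space M \<subseteq> closure (E j)"
      by (rule choice) (use F in \<open>auto simp: strongly_measurable_def\<close>)
    then obtain E where E: "\<And>j. countable (E j)"
        "\<And>j. (\<lambda>\<omega>. F \<omega> (d j)) ` space M \<subseteq> closure (E j)"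
      by auto
    have "(\<lambda>\<omega>. F \<omega> (d (i m \<omega>))) ` space M \<subseteq> closure (\<Union>j. E j)"
    proof (rule image_subsetI)
      fix \<omega> assume "\<omega> \<in> space M"
      then show "F \<omega> (d (i m \<omega>)) \<in> closure (\<Union>j. E j)"
        using E(2)[of "i m \<omega>"] closure_mono[of "E (i m \<omega>)" "\<Union>j. E j"] by auto
    qed
    moreover have "(\<lambda>\<omega>. F \<omega> (d (i m \<omega>))) \<in> borel_measurable M"
      by (rule measurable_compose_countable[OF _ i_meas])
        (use F in \<open>simp add: strongly_measurable_def\<close>)
    ultimately show "strongly_measurable M (\<lambda>\<omega>. F \<omega> (d (i m \<omega>)))"
      using E(1) by (auto simp: strongly_measurable_def intro!: exI[of _ "\<Union>j. E j"])
  next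
    fix \<omega> assume \<omega>: "\<omega> \<in> space M"
    have "(\<lambda>m. d (i m \<omega>)) \<longlonglongrightarrow> f \<omega>"
    proof (rule metric_LIMSEQ_I)
      fix r :: real assume "r > 0"
      then obtain N where N: "1 / real (Suc N) < r"
        using nat_approx_posE by blast
      have "dist (d (i m \<omega>)) (f \<omega>) < r" if "m \<ge> N" for m
      proof -
        have "1 / real (Suc m) \<le> 1 / real (Suc N)"
          using that by (simp add: frac_le)
        then show ?thesis
          using i_close[OF \<omega>, of m] N by (simp add: dist_commute)
      qed
      then show "\<exists>no. \<forall>n\<ge>no. dist (d (i n \<omega>)) (f \<omega>) < r" by blast
    qed
    then show "(\<lambda>m. F \<omega> (d (i m \<omega>))) \<longlonglongrightarrow> F \<omega> (f \<omega>)"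
      using continuous_on_tendsto_compose[OF cont[OF \<omega>]] by auto
  qed
qed

lemma strongly_measurable_const: "strongly_measurable M (\<lambda>_. c)"
  by (auto simp: strongly_measurable_def intro!: exI[of _ "{c}"])

text \<open>Addition of \<open>g \<omega>\<close> is a random continuous map. The Borel rule for sums does not apply here,
  because the Borel sets of a product of two nonseparable spaces need not be generated by
  rectangles.\<close>

lemma strongly_measurable_add:
  assumes f: "strongly_measurable M f" and g: "strongly_measurable M g"
  shows "strongly_measurable M (\<lambda>\<omega>. f \<omega> + g \<omega>)"
  by (rule strongly_measurable_caratheodory[OF _ _ f])
    (auto intro!: strongly_measurable_continuous[OF g] continuous_intros)

lemma strongly_measurable_sum:
  fixes N :: nat
  assumes "\<And>n. strongly_measurable M (f n)"
  shows "strongly_measurable M (\<lambda>\<omega>. \<Sum>n<N. f n \<omega>)"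
  using assms
  by (induction N) (auto intro: strongly_measurable_const strongly_measurable_add)

lemma strongly_measurable_blinfun_apply:
  assumes "\<And>x. strongly_measurable M (\<lambda>\<omega>. blinfun_apply (F \<omega>) x)"
    and "strongly_measurable M f"
  shows "strongly_measurable M (\<lambda>\<omega>. F \<omega> (f \<omega>))"
  by (rule strongly_measurable_caratheodory[OF assms(1) _ assms(2)])
    (intro linear_continuous_on blinfun.bounded_linear_right)

lemma strongly_measurable_extend_zero:
  assumes G: "G \<in> sets M" and f: "strongly_measurable (restrict_space M G) f"
  shows "strongly_measurable M (\<lambda>\<omega>. if \<omega> \<in> G then f \<omega> else 0)"
proof -
  have space_G: "space (restrict_space M G) = G"
    using sets.sets_into_space[OF G] by (auto simp: space_restrict_space)
  obtain D where D: "countable D" "f ` G \<subseteq> closure D"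
    using f space_G by (auto simp: strongly_measurable_def)
  have "(\<lambda>\<omega>. if \<omega> \<in> G then f \<omega> else 0) \<in> borel_measurable M"
    by (subst measurable_If_restrict_space_iff)
      (use f G in \<open>auto simp: strongly_measurable_def Int_def[symmetric]\<close>)
  moreover have "(\<lambda>\<omega>. if \<omega> \<in> G then f \<omega> else 0) ` space M \<subseteq> closure (insert 0 D)"
    using D(2) closure_mono[of D "insert 0 D"] closure_subset[of "insert 0 D"] by auto
  ultimately show ?thesis
    using D(1) by (auto simp: strongly_measurable_def intro!: exI[of _ "insert 0 D"])
qed

lemma strongly_measurable_cocycle:
  assumes \<sigma>: "\<sigma> \<in> measurable M M" and L: "\<And>x. strongly_measurable M (\<lambda>\<omega>. blinfun_apply (L \<omega>) x)"
  shows "strongly_measurable M (\<lambda>\<omega>. blinfun_apply (cocycle \<sigma> L n \<omega>) x)"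
proof (induction n)
  case 0
  then show ?case by (simp add: strongly_measurable_const)
next
  case (Suc n)
  have "\<sigma> ^^ n \<in> measurable M M"
    using \<sigma> by (rule measurable_compose_n)
  then have "strongly_measurable M (\<lambda>\<omega>. L ((\<sigma> ^^ n) \<omega>) y)" for y
    by (rule strongly_measurable_compose[OF L])
  then show ?case
    using strongly_measurable_blinfun_apply[of M "\<lambda>\<omega>. L ((\<sigma> ^^ n) \<omega>)", OF _ Suc.IH] by simp
qed

section \<open>Iterates of an automorphism\<close>

lemma mp_automorphism_inverse:
  assumes "mp_automorphism M \<sigma>"
  defines "\<tau> \<equiv> the_inv_into (space M) \<sigma>"
  shows "\<omega> \<in> space M \<Longrightarrow> \<sigma> \<omega> \<in> space M"
    and "\<omega> \<in> space M \<Longrightarrow> \<tau> \<omega> \<in> space M"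
    and "\<omega> \<in> space M \<Longrightarrow> \<sigma> (\<tau> \<omega>) = \<omega>"
    and "\<omega> \<in> space M \<Longrightarrow> \<tau> (\<sigma> \<omega>) = \<omega>"
proof -
  have bij: "bij_betw \<sigma> (space M) (space M)"
    using assms by (simp add: mp_automorphism_def)
  then show "\<omega> \<in> space M \<Longrightarrow> \<sigma> \<omega> \<in> space M"
    by (auto simp: bij_betw_def)
  show "\<omega> \<in> space M \<Longrightarrow> \<tau> \<omega> \<in> space M"
    using bij unfolding \<tau>_def by (metis bij_betwE bij_betw_the_inv_into)
  show "\<omega> \<in> space M \<Longrightarrow> \<sigma> (\<tau> \<omega>) = \<omega>"
    using bij unfolding \<tau>_def by (rule f_the_inv_into_f_bij_betw)
  show "\<omega> \<in> space M \<Longrightarrow> \<tau> (\<sigma> \<omega>) = \<omega>"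
    using bij unfolding \<tau>_def by (auto simp: bij_betw_def intro: the_inv_into_f_f)
qed

lemma zpow_0 [simp]: "zpow M \<sigma> 0 \<omega> = \<omega>"
  by (simp add: zpow_def)

lemma zpow_measurable:
  assumes "mp_automorphism M \<sigma>"
  shows "zpow M \<sigma> n \<in> measurable M M"
proof -
  have *: "g ^^ k \<in> measurable M M" if "g \<in> measurable M M" for g :: "'a \<Rightarrow> 'a" and k
    using that by (rule measurable_compose_n)
  show ?thesis
    using assms by (auto simp: mp_automorphism_def zpow_def intro!: *)
qed

lemma zpow_in_space:
  "mp_automorphism M \<sigma> \<Longrightarrow> \<omega> \<in> space M \<Longrightarrow> zpow M \<sigma> n \<omega> \<in> space M"
  using measurable_space[OF zpow_measurable] .

lemma zpow_succ:
  assumes "mp_automorphism M \<sigma>" "\<omega> \<in> space M"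
  shows "zpow M \<sigma> (n + 1) \<omega> = \<sigma> (zpow M \<sigma> n \<omega>)"
proof (cases "n \<ge> 0")
  case True
  then have "nat (n + 1) = Suc (nat n)" by simp
  then show ?thesis using True by (simp add: zpow_def)
next
  case False
  let ?\<tau> = "the_inv_into (space M) \<sigma>"
  define k where "k = nat (- (n + 1))"
  have "nat (- n) = Suc k"
    using False by (auto simp: k_def)
  then have "zpow M \<sigma> n \<omega> = ?\<tau> ((?\<tau> ^^ k) \<omega>)"
    using False by (simp add: zpow_def)
  moreover have succ: "zpow M \<sigma> (n + 1) \<omega> = (?\<tau> ^^ k) \<omega>"
  proof (cases "n = - 1")
    case True
    then show ?thesis by (simp add: k_def)
  next
    case False
    with \<open>\<not> n \<ge> 0\<close> show ?thesis by (simp add: zpow_def k_def)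
  qed
  moreover have "(?\<tau> ^^ k) \<omega> \<in> space M"
    using zpow_in_space[OF assms, of "n + 1"] succ by simp
  ultimately show ?thesis
    using mp_automorphism_inverse(3)[OF assms(1)] by simp
qed

lemma zpow_pred:
  assumes "mp_automorphism M \<sigma>" "\<omega> \<in> space M"
  shows "zpow M \<sigma> (n - 1) \<omega> = the_inv_into (space M) \<sigma> (zpow M \<sigma> n \<omega>)"
proof -
  have "zpow M \<sigma> n \<omega> = \<sigma> (zpow M \<sigma> (n - 1) \<omega>)"
    using zpow_succ[OF assms, of "n - 1"] by simp
  then show ?thesis
    using mp_automorphism_inverse(4)[OF assms(1) zpow_in_space[OF assms]] by simp
qed

lemma zpow_add:
  assumes "mp_automorphism M \<sigma>" "\<omega> \<in> space M"
  shows "zpow M \<sigma> m (zpow M \<sigma> n \<omega>) = zpow M \<sigma> (m + n) \<omega>"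
proof (induction m rule: int_induct[where k = 0])
  case base
  then show ?case by simp
next
  case (step1 i)
  have "zpow M \<sigma> (i + 1) (zpow M \<sigma> n \<omega>) = \<sigma> (zpow M \<sigma> (i + n) \<omega>)"
    using zpow_succ[OF assms(1) zpow_in_space[OF assms]] step1 by simp
  also have "\<dots> = zpow M \<sigma> (i + 1 + n) \<omega>"
    using zpow_succ[OF assms, of "i + n"] by (simp add: algebra_simps)
  finally show ?case .
next
  case (step2 i)
  have "zpow M \<sigma> (i - 1) (zpow M \<sigma> n \<omega>) = the_inv_into (space M) \<sigma> (zpow M \<sigma> (i + n) \<omega>)"
    using zpow_pred[OF assms(1) zpow_in_space[OF assms]] step2 by simp
  also have "\<dots> = zpow M \<sigma> (i - 1 + n) \<omega>"
    using zpow_pred[OF assms, of "i + n"] by (simp add: algebra_simps)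
  finally show ?case .
qed

lemma AE_zpow:
  assumes aut: "mp_automorphism M \<sigma>" and P: "AE \<omega> in M. P \<omega>"
  shows "AE \<omega> in M. P (zpow M \<sigma> n \<omega>)"
proof -
  let ?\<tau> = "the_inv_into (space M) \<sigma>"
  have \<sigma>: "\<sigma> \<in> measurable M M" "distr M M \<sigma> = M" and \<tau>: "?\<tau> \<in> measurable M M"
    using aut by (auto simp: mp_automorphism_def)
  have "distr M M ?\<tau> = distr (distr M M \<sigma>) M ?\<tau>"
    using \<sigma> by simp
  also have "\<dots> = distr M M (?\<tau> \<circ> \<sigma>)"
    by (rule distr_distr[OF \<tau> \<sigma>(1)])
  also have "\<dots> = distr M M (\<lambda>x. x)"
    by (rule distr_cong) (auto simp: mp_automorphism_inverse[OF aut])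
  finally have \<tau>_distr: "distr M M ?\<tau> = M" by simp
  have iter: "AE \<omega> in M. P ((g ^^ k) \<omega>)"
    if g: "g \<in> measurable M M" "distr M M g = M" for g k
  proof (induction k)
    case 0
    then show ?case using P by simp
  next
    case (Suc k)
    then have "AE \<omega> in distr M M g. P ((g ^^ k) \<omega>)" unfolding g(2) .
    then have "AE \<omega> in M. P ((g ^^ k) (g \<omega>))" by (rule AE_distrD[OF g(1)])
    then show ?case by (simp add: funpow_swap1)
  qed
  show ?thesis
    using iter[OF \<sigma>] iter[OF \<tau> \<tau>_distr] by (auto simp: zpow_def)
qed

text \<open>Intersecting all translates of the set where \<open>P\<close> holds costs only countably many null sets.
  On the resulting set, \<open>P\<close> may be used along whole orbits.\<close>

lemma invariant_full_measure_subset: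
  assumes aut: "mp_automorphism M \<sigma>" and P: "AE \<omega> in M. P \<omega>"
  obtains G where "G \<in> sets M" "AE \<omega> in M. \<omega> \<in> G" "\<And>\<omega>. \<omega> \<in> G \<Longrightarrow> P \<omega>"
    "\<And>\<omega> n. \<omega> \<in> G \<Longrightarrow> zpow M \<sigma> n \<omega> \<in> G"
proof -
  obtain N where N: "{\<omega> \<in> space M. \<not> P \<omega>} \<subseteq> N" "N \<in> null_sets M"
    using P by (auto elim!: AE_E)
  define G where "G = {\<omega> \<in> space M. \<forall>n::int. zpow M \<sigma> n \<omega> \<in> space M - N}"
  have [measurable]: "zpow M \<sigma> n \<in> measurable M M" for n by (rule zpow_measurable[OF aut])
  have [measurable]: "N \<in> sets M" using N(2) by auto
  have "G \<in> sets M" unfolding G_def by measurable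
  moreover have "AE \<omega> in M. \<omega> \<in> G"
  proof -
    have "AE \<omega> in M. \<omega> \<notin> N" by (rule AE_not_in[OF N(2)])
    then have "AE \<omega> in M. \<forall>n::int. zpow M \<sigma> n \<omega> \<notin> N"
      unfolding AE_all_countable by (intro allI AE_zpow[OF aut])
    then show ?thesis
      by (rule AE_mp) (auto simp: G_def zpow_in_space[OF aut])
  qed
  moreover have "P \<omega>" if "\<omega> \<in> G" for \<omega>
    using that N(1) unfolding G_def by (auto dest!: spec[of _ 0])
  moreover have "zpow M \<sigma> n \<omega> \<in> G" if "\<omega> \<in> G" for \<omega> n
    using that by (auto simp: G_def zpow_add[OF aut] zpow_in_space[OF aut])
  ultimately show ?thesis using that by blast
qed

section \<open>Tempered random variables\<close>

text \<open>The bound on the right holds at every index, with a constant that absorbs the finitely many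
  exceptional ones. In this form sublinear growth passes through shifts, suprema and products
  without any further limits.\<close>

lemma sublinear_iff:
  fixes x :: "int \<Rightarrow> real"
  shows "((\<lambda>n. 1 / of_int n * x n) \<longlongrightarrow> 0) at_top \<and> ((\<lambda>n. 1 / of_int n * x n) \<longlongrightarrow> 0) at_bot \<longleftrightarrow>
    (\<forall>\<eta>>0. \<exists>A. \<forall>n. \<bar>x n\<bar> \<le> A + \<eta> * \<bar>of_int n\<bar>)" (is "?lim \<longleftrightarrow> ?bound")
proof
  assume lim: ?lim
  show ?bound
  proof (intro allI impI)
    fix \<eta> :: real assume "\<eta> > 0"
    have "\<forall>\<^sub>F n in at_top. \<bar>1 / of_int n * x n\<bar> < \<eta>" "\<forall>\<^sub>F n in at_bot. \<bar>1 / of_int n * x n\<bar> < \<eta>"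
      using lim \<open>\<eta> > 0\<close> by (auto simp: tendsto_iff dist_real_def)
    then obtain p q where pq: "\<And>n. n \<ge> p \<Longrightarrow> \<bar>1 / of_int n * x n\<bar> < \<eta>"
        "\<And>n. n \<le> q \<Longrightarrow> \<bar>1 / of_int n * x n\<bar> < \<eta>"
      by (auto simp: eventually_at_top_linorder eventually_at_bot_linorder)
    let ?S = "{min q 0..max p 0}"
    have "\<bar>x n\<bar> \<le> (\<Sum>m\<in>?S. \<bar>x m\<bar>) + \<eta> * \<bar>of_int n\<bar>" for n
    proof (cases "n \<in> ?S")
      case True
      then have "\<bar>x n\<bar> \<le> (\<Sum>m\<in>?S. \<bar>x m\<bar>)"
        by (intro member_le_sum) auto
      then show ?thesis using \<open>\<eta> > 0\<close> by (simp add: add_increasing2)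
    next
      case False
      then have "n \<noteq> 0" and "\<bar>1 / of_int n * x n\<bar> < \<eta>"
        using pq[of n] by (auto simp: not_le)
      then have "\<bar>x n\<bar> < \<eta> * \<bar>of_int n\<bar>"
        by (simp add: abs_mult divide_simps)
      moreover have "0 \<le> (\<Sum>m\<in>?S. \<bar>x m\<bar>)" by (rule sum_nonneg) simp
      ultimately show ?thesis by linarith
    qed
    then show "\<exists>A. \<forall>n. \<bar>x n\<bar> \<le> A + \<eta> * \<bar>of_int n\<bar>" by blast
  qed
next
  assume bound: ?bound
  have key: "\<exists>p. \<forall>n. \<bar>n\<bar> \<ge> p \<longrightarrow> \<bar>1 / of_int n * x n\<bar> < \<eta>" if "\<eta> > 0" for \<eta> :: real
  proof -
    obtain A where A: "\<And>n. \<bar>x n\<bar> \<le> A + \<eta> / 2 * \<bar>of_int n\<bar>"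
      using bound \<open>\<eta> > 0\<close> by (meson half_gt_zero)
    obtain p :: int where p: "of_int p > max 0 (A / (\<eta> / 2))"
      using ex_less_of_int by blast
    have "\<bar>1 / of_int n * x n\<bar> < \<eta>" if "\<bar>n\<bar> \<ge> p" for n
    proof -
      have n: "max 0 (A / (\<eta> / 2)) < \<bar>of_int n\<bar>"
        using p that by (metis less_le_trans of_int_abs of_int_le_iff)
      then have "A < \<eta> / 2 * \<bar>of_int n\<bar>"
        using \<open>\<eta> > 0\<close> by (simp add: divide_simps mult.commute)
      then have "\<bar>x n\<bar> < \<eta> * \<bar>of_int n\<bar>" using A[of n] by simp
      then show ?thesis using n by (simp add: abs_mult divide_simps split: if_splits)
    qed
    then show ?thesis by blast
  qed
  show ?lim
  proof (intro conjI tendstoI)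
    fix \<eta> :: real assume "\<eta> > 0"
    then obtain p where p: "\<And>n. \<bar>n\<bar> \<ge> p \<Longrightarrow> \<bar>1 / of_int n * x n\<bar> < \<eta>" using key by blast
    show "\<forall>\<^sub>F n in at_top. dist (1 / of_int n * x n) 0 < \<eta>"
      unfolding eventually_at_top_linorder dist_real_def using p by (auto intro!: exI[of _ p])
    show "\<forall>\<^sub>F n in at_bot. dist (1 / of_int n * x n) 0 < \<eta>"
      unfolding eventually_at_bot_linorder dist_real_def using p by (auto intro!: exI[of _ "- p"])
  qed
qed

lemma temperedI:
  assumes "K \<in> borel_measurable M" "\<And>\<omega>. \<omega> \<in> space M \<Longrightarrow> K \<omega> > 0"
    and "AE \<omega> in M. \<forall>\<eta>>0. \<exists>A. \<forall>n. \<bar>ln (K (zpow M \<sigma> n \<omega>))\<bar> \<le> A + \<eta> * \<bar>of_int n\<bar>"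
  shows "tempered M \<sigma> K"
  using assms unfolding tempered_def sublinear_iff by blast

lemma temperedD:
  assumes "tempered M \<sigma> K"
  shows "AE \<omega> in M. \<forall>\<eta>>0. \<exists>A. \<forall>n. \<bar>ln (K (zpow M \<sigma> n \<omega>))\<bar> \<le> A + \<eta> * \<bar>of_int n\<bar>"
  using assms unfolding tempered_def sublinear_iff by blast

lemma tempered_scale_power:
  assumes B: "tempered M \<sigma> B" and c: "c > 0"
    and aut: "mp_automorphism M \<sigma>"
  shows "tempered M \<sigma> (\<lambda>\<omega>. c * B \<omega> ^ m)"
proof (rule temperedI)
  have pos: "B \<omega> > 0" if "\<omega> \<in> space M" for \<omega>
    using B that by (simp add: tempered_def)
  have [measurable]: "B \<in> borel_measurable M"
    using B by (simp add: tempered_def)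
  show "(\<lambda>\<omega>. c * B \<omega> ^ m) \<in> borel_measurable M" by measurable
  show "c * B \<omega> ^ m > 0" if "\<omega> \<in> space M" for \<omega>
    using pos[OF that] c by simp
  show "AE \<omega> in M. \<forall>\<eta>>0. \<exists>A. \<forall>n. \<bar>ln (c * B (zpow M \<sigma> n \<omega>) ^ m)\<bar> \<le> A + \<eta> * \<bar>of_int n\<bar>"
    using temperedD[OF B] AE_space
  proof eventually_elim
    case (elim \<omega>)
    show ?case
    proof (intro allI impI)
      fix \<eta> :: real assume "\<eta> > 0"
      then have "\<eta> / (real m + 1) > 0" by simp
      then obtain A where
          A: "\<And>n. \<bar>ln (B (zpow M \<sigma> n \<omega>))\<bar> \<le> A + \<eta> / (real m + 1) * \<bar>of_int n\<bar>"
        using elim(1) by blast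
      have "\<bar>ln (c * B (zpow M \<sigma> n \<omega>) ^ m)\<bar> \<le> (\<bar>ln c\<bar> + real m * A) + \<eta> * \<bar>of_int n\<bar>" for n
      proof -
        have "B (zpow M \<sigma> n \<omega>) > 0"
          using pos zpow_in_space[OF aut elim(2)] by blast
        then have "\<bar>ln (c * B (zpow M \<sigma> n \<omega>) ^ m)\<bar> \<le> \<bar>ln c\<bar> + real m * \<bar>ln (B (zpow M \<sigma> n \<omega>))\<bar>"
          using c abs_triangle_ineq[of "ln c" "real m * ln (B (zpow M \<sigma> n \<omega>))"]
          by (simp add: ln_mult ln_realpow abs_mult)
        also have "\<dots> \<le> \<bar>ln c\<bar> + real m * (A + \<eta> / (real m + 1) * \<bar>of_int n\<bar>)"
          using A by (intro add_left_mono mult_left_mono) auto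
        also have "\<dots> \<le> (\<bar>ln c\<bar> + real m * A) + \<eta> * \<bar>of_int n\<bar>"
        proof -
          have "real m * (\<eta> / (real m + 1)) \<le> \<eta>"
            using \<open>\<eta> > 0\<close> by (simp add: divide_simps)
          then have "real m * (\<eta> / (real m + 1)) * \<bar>of_int n\<bar> \<le> \<eta> * \<bar>of_int n\<bar>"
            by (rule mult_right_mono) simp
          then show ?thesis by (simp add: algebra_simps)
        qed
        finally show ?thesis .
      qed
      then show "\<exists>A. \<forall>n. \<bar>ln (c * B (zpow M \<sigma> n \<omega>) ^ m)\<bar> \<le> A + \<eta> * \<bar>of_int n\<bar>" by blast
    qed
  qed
qed

text \<open>A tempered variable lies below a tempered one that grows at most by the factor
  \<open>exp (\<delta> * \<bar>n\<bar>)\<close> along each orbit, for a prescribed \<open>\<delta>\<close>: take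
  \<open>B \<omega> = (SUP n. max (C (\<sigma>\<^sup>n \<omega>)) 1 * exp (- \<delta> * \<bar>n\<bar>))\<close>. The growth bound for \<open>B\<close> is the triangle
  inequality for \<open>\<bar>n\<bar>\<close>. That \<open>B\<close> is tempered, and not merely of exponential rate at most \<open>\<delta>\<close>, follows
  by going back to \<open>C\<close>: if \<open>C\<close> has growth rate at most \<open>\<eta> \<le> \<delta>\<close> along an orbit, so has \<open>B\<close>.\<close>

lemma tempered_envelope:
  assumes aut: "mp_automorphism M \<sigma>" and C: "tempered M \<sigma> C"
    and P: "AE \<omega> in M. P \<omega>" and \<delta>: "\<delta> > 0"
  obtains B G where "G \<in> sets M" "AE \<omega> in M. \<omega> \<in> G" "\<And>\<omega>. \<omega> \<in> G \<Longrightarrow> P \<omega>"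
    "\<And>\<omega> n. \<omega> \<in> G \<Longrightarrow> zpow M \<sigma> n \<omega> \<in> G"
    "tempered M \<sigma> B" "\<And>\<omega>. \<omega> \<in> G \<Longrightarrow> 1 \<le> B \<omega>" "\<And>\<omega>. \<omega> \<in> G \<Longrightarrow> C \<omega> \<le> B \<omega>"
    "\<And>\<omega> n. \<omega> \<in> G \<Longrightarrow> B (zpow M \<sigma> n \<omega>) \<le> B \<omega> * exp (\<delta> * \<bar>of_int n\<bar>)"
proof -
  have "AE \<omega> in M. P \<omega> \<and> (\<forall>\<eta>>0. \<exists>A. \<forall>n. \<bar>ln (C (zpow M \<sigma> n \<omega>))\<bar> \<le> A + \<eta> * \<bar>of_int n\<bar>)"
    using P temperedD[OF C] by eventually_elim simp
  then obtain G where G: "G \<in> sets M" "AE \<omega> in M. \<omega> \<in> G"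
    and G_P: "\<And>\<omega>. \<omega> \<in> G \<Longrightarrow> P \<omega>"
    and G_ln: "\<And>\<omega> \<eta>. \<omega> \<in> G \<Longrightarrow> \<eta> > 0 \<Longrightarrow> \<exists>A. \<forall>n. \<bar>ln (C (zpow M \<sigma> n \<omega>))\<bar> \<le> A + \<eta> * \<bar>of_int n\<bar>"
    and G_inv: "\<And>\<omega> n. \<omega> \<in> G \<Longrightarrow> zpow M \<sigma> n \<omega> \<in> G"
    by (rule invariant_full_measure_subset[OF aut]) blast
  have G_space: "\<omega> \<in> space M" if "\<omega> \<in> G" for \<omega>
    using that sets.sets_into_space[OF G(1)] by auto
  have C_pos: "C \<omega> > 0" if "\<omega> \<in> space M" for \<omega>
    using C that by (simp add: tempered_def)
  have C_meas: "C \<in> borel_measurable M"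
    using C by (simp add: tempered_def)
  have growth: "\<exists>A\<ge>0. \<forall>n. max (C (zpow M \<sigma> n \<omega>)) 1 \<le> exp (A + \<eta> * \<bar>of_int n\<bar>)"
    if \<omega>: "\<omega> \<in> G" and "\<eta> > 0" for \<omega> \<eta>
  proof -
    obtain A where A: "\<And>n. \<bar>ln (C (zpow M \<sigma> n \<omega>))\<bar> \<le> A + \<eta> * \<bar>of_int n\<bar>"
      using G_ln[OF \<omega> \<open>\<eta> > 0\<close>] by blast
    have "A \<ge> 0"
      using A[of 0] by simp
    have "max (C (zpow M \<sigma> n \<omega>)) 1 \<le> exp (A + \<eta> * \<bar>of_int n\<bar>)" for n
    proof -
      have "C (zpow M \<sigma> n \<omega>) > 0"
        by (intro C_pos zpow_in_space[OF aut] G_space \<omega>)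
      moreover have "ln (C (zpow M \<sigma> n \<omega>)) \<le> A + \<eta> * \<bar>of_int n\<bar>"
        using A[of n] by linarith
      ultimately have "C (zpow M \<sigma> n \<omega>) \<le> exp (A + \<eta> * \<bar>of_int n\<bar>)"
        using ln_ge_iff by (metis exp_le_cancel_iff exp_ln)
      then show ?thesis using \<open>A \<ge> 0\<close> \<open>\<eta> > 0\<close> by simp
    qed
    then show ?thesis using \<open>A \<ge> 0\<close> by blast
  qed
  \<comment> \<open>The value 1 off \<open>G\<close> keeps the supremum bounded at every point, as measurability of the
    supremum demands.\<close>
  define f where "f n \<omega> = (if \<omega> \<in> G then max (C (zpow M \<sigma> n \<omega>)) 1 * exp (- \<delta> * \<bar>of_int n\<bar>) else 1)"
    for n :: int and \<omega>
  define B where "B \<omega> = (SUP n. f n \<omega>)" for \<omega>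
  have bdd: "bdd_above (range (\<lambda>n. f n \<omega>))" for \<omega>
  proof (cases "\<omega> \<in> G")
    case True
    obtain A where A: "\<And>n. max (C (zpow M \<sigma> n \<omega>)) 1 \<le> exp (A + \<delta> * \<bar>of_int n\<bar>)"
      using growth[OF True \<delta>] by blast
    have "f n \<omega> \<le> exp A" for n
    proof -
      have "f n \<omega> \<le> exp (A + \<delta> * \<bar>of_int n\<bar>) * exp (- \<delta> * \<bar>of_int n\<bar>)"
        using True A[of n] by (simp add: f_def mult_right_mono)
      then show ?thesis by (simp flip: exp_add)
    qed
    then show ?thesis by (intro bdd_aboveI2)
  qed (simp add: f_def)
  have f_le_B: "f n \<omega> \<le> B \<omega>" for n \<omega>
    unfolding B_def by (rule cSUP_upper[OF UNIV_I bdd])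
  have B_outside: "B \<omega> = 1" if "\<omega> \<notin> G" for \<omega>
    using that by (simp add: B_def f_def)
  have B_ge: "max (C \<omega>) 1 \<le> B \<omega>" if "\<omega> \<in> G" for \<omega>
    using f_le_B[of 0 \<omega>] that by (simp add: f_def)
  have [measurable]: "f n \<in> borel_measurable M" for n
    unfolding f_def using G(1) measurable_compose[OF zpow_measurable[OF aut] C_meas]
    by measurable
  have "B \<in> borel_measurable M"
    unfolding B_def by (rule borel_measurable_cSUP) (auto intro: bdd)
  moreover have "B \<omega> > 0" for \<omega>
    using B_ge[of \<omega>] B_outside[of \<omega>] by (cases "\<omega> \<in> G") auto
  moreover have "AE \<omega> in M. \<forall>\<eta>>0. \<exists>A. \<forall>n. \<bar>ln (B (zpow M \<sigma> n \<omega>))\<bar> \<le> A + \<eta> * \<bar>of_int n\<bar>"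
    using G(2)
  proof eventually_elim
    case (elim \<omega>)
    show ?case
    proof (intro allI impI)
      fix \<eta>' :: real assume "\<eta>' > 0"
      define \<eta> where "\<eta> = min \<eta>' \<delta>"
      have \<eta>: "\<eta> > 0" "\<eta> \<le> \<eta>'" "\<eta> \<le> \<delta>"
        using \<open>\<eta>' > 0\<close> \<delta> by (auto simp: \<eta>_def)
      obtain A where A: "\<And>n. max (C (zpow M \<sigma> n \<omega>)) 1 \<le> exp (A + \<eta> * \<bar>of_int n\<bar>)"
        using growth[OF elim \<eta>(1)] by blast
      have "\<bar>ln (B (zpow M \<sigma> n \<omega>))\<bar> \<le> A + \<eta>' * \<bar>of_int n\<bar>" for n
      proof -
        have n_G: "zpow M \<sigma> n \<omega> \<in> G" using G_inv[OF elim] .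
        have "f m (zpow M \<sigma> n \<omega>) \<le> exp (A + \<eta> * \<bar>of_int n\<bar>)" for m
        proof -
          have "f m (zpow M \<sigma> n \<omega>) \<le> exp (A + \<eta> * \<bar>of_int (m + n)\<bar>) * exp (- \<delta> * \<bar>of_int m\<bar>)"
            using n_G A[of "m + n"] zpow_add[OF aut G_space[OF elim]]
            by (simp add: f_def mult_right_mono)
          also have "\<dots> = exp (A + \<eta> * \<bar>of_int (m + n)\<bar> - \<delta> * \<bar>of_int m\<bar>)"
            by (simp flip: exp_add)
          also have "\<dots> \<le> exp (A + \<eta> * \<bar>of_int n\<bar>)"
          proof -
            have "\<eta> * \<bar>of_int (m + n)\<bar> \<le> \<eta> * (\<bar>of_int m\<bar> + \<bar>of_int n\<bar>)"
              using \<eta>(1) by (intro mult_left_mono) auto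
            moreover have "\<eta> * \<bar>of_int m\<bar> \<le> \<delta> * \<bar>of_int m\<bar>"
              using \<eta>(3) by (intro mult_right_mono) auto
            ultimately show ?thesis by (simp add: algebra_simps)
          qed
          finally show ?thesis .
        qed
        then have "B (zpow M \<sigma> n \<omega>) \<le> exp (A + \<eta> * \<bar>of_int n\<bar>)"
          unfolding B_def by (intro cSUP_least) auto
        moreover have "B (zpow M \<sigma> n \<omega>) \<ge> 1" using B_ge[OF n_G] by simp
        ultimately have "\<bar>ln (B (zpow M \<sigma> n \<omega>))\<bar> \<le> A + \<eta> * \<bar>of_int n\<bar>"
          by (metis abs_of_nonneg ln_exp ln_ge_zero ln_mono less_le_trans zero_less_one)
        also have "\<dots> \<le> A + \<eta>' * \<bar>of_int n\<bar>"
          using \<eta>(2) by (intro add_left_mono mult_right_mono) auto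
        finally show ?thesis .
      qed
      then show "\<exists>A. \<forall>n. \<bar>ln (B (zpow M \<sigma> n \<omega>))\<bar> \<le> A + \<eta>' * \<bar>of_int n\<bar>" by blast
    qed
  qed
  ultimately have "tempered M \<sigma> B" by (intro temperedI)
  moreover have "B (zpow M \<sigma> n \<omega>) \<le> B \<omega> * exp (\<delta> * \<bar>of_int n\<bar>)" if "\<omega> \<in> G" for \<omega> n
  proof -
    have "f m (zpow M \<sigma> n \<omega>) \<le> B \<omega> * exp (\<delta> * \<bar>of_int n\<bar>)" for m
    proof -
      let ?c = "max (C (zpow M \<sigma> (m + n) \<omega>)) 1"
      have "f m (zpow M \<sigma> n \<omega>) = ?c * exp (- \<delta> * \<bar>of_int m\<bar>)"
        using G_inv[OF that] zpow_add[OF aut G_space[OF that]] by (simp add: f_def)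
      also have "\<dots> \<le> ?c * exp (- \<delta> * \<bar>of_int (m + n)\<bar> + \<delta> * \<bar>of_int n\<bar>)"
      proof -
        have "\<delta> * \<bar>of_int (m + n)\<bar> \<le> \<delta> * (\<bar>of_int m\<bar> + \<bar>of_int n\<bar>)"
          using \<delta> by (intro mult_left_mono) auto
        then show ?thesis by (intro mult_left_mono) (auto simp: algebra_simps)
      qed
      also have "\<dots> = f (m + n) \<omega> * exp (\<delta> * \<bar>of_int n\<bar>)"
        using that by (simp only: f_def if_True exp_add mult.assoc)
      also have "\<dots> \<le> B \<omega> * exp (\<delta> * \<bar>of_int n\<bar>)"
        using f_le_B by (intro mult_right_mono) auto
      finally show ?thesis .
    qed
    then show ?thesis unfolding B_def[of "zpow M \<sigma> n \<omega>"] by (intro cSUP_least) auto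
  qed
  ultimately show ?thesis
    using that[of G B] G G_P G_inv B_ge by simp
qed

section \<open>Series along a backward orbit\<close>

lemma cocycle_Suc_shift: "cocycle \<sigma> L (Suc n) \<omega> = cocycle \<sigma> L n (\<sigma> \<omega>) o\<^sub>L L \<omega>"
  by (induction n) (auto simp: blinfun_eqI funpow_swap1 intro!: blinfun_eqI)

text \<open>Iterating \<open>d n = A n (d (n + 1)) + u n\<close> expresses \<open>d 0\<close> by the past forcing \<open>u\<close>, up to the
  contribution \<open>T n (d n)\<close> of the remote past.\<close>

lemma telescoping_sums:
  fixes T A :: "nat \<Rightarrow> 'b::real_normed_vector \<Rightarrow>\<^sub>L 'b"
  assumes T: "T 0 = id_blinfun" "\<And>n. T (Suc n) = T n o\<^sub>L A n"
    and d: "\<And>n. d n = A n (d (Suc n)) + u n"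
    and lim: "(\<lambda>n. T n (d n)) \<longlonglongrightarrow> 0"
  shows "(\<lambda>n. T n (u n)) sums d 0"
proof -
  have step: "T n (u n) = T n (d n) - T (Suc n) (d (Suc n))" for n
    by (subst d[of n]) (simp add: T blinfun.add_right)
  have "(\<lambda>n. T n (u n)) sums (T 0 (d 0) - 0)"
    unfolding step by (rule telescope_sums'[OF lim])
  then show ?thesis by (simp add: T)
qed

lemma norm_sums_geometric:
  fixes f :: "nat \<Rightarrow> 'b::real_normed_vector"
  assumes f: "f sums s" and bound: "\<And>n. norm (f n) \<le> a * q ^ n" and q: "0 \<le> q" "q < 1"
  shows "norm s \<le> a / (1 - q)"
proof -
  have geo: "(\<lambda>n. a * q ^ n) sums (a / (1 - q))"
    using sums_mult[OF geometric_sums[of q], of a] q by simp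
  have "norm (\<Sum>n<N. f n) \<le> a / (1 - q)" for N
  proof -
    have "norm (\<Sum>n<N. f n) \<le> (\<Sum>n<N. a * q ^ n)"
      by (rule order_trans[OF norm_sum sum_mono]) (rule bound)
    also have "\<dots> \<le> a / (1 - q)"
      using sum_le_suminf[OF sums_summable[OF geo], of "{..<N}"] sums_unique[OF geo]
        order_trans[OF norm_ge_zero bound] by auto
    finally show ?thesis .
  qed
  moreover have "(\<lambda>N. norm (\<Sum>n<N. f n)) \<longlonglongrightarrow> norm s"
    using f unfolding sums_def by (rule tendsto_norm)
  ultimately show ?thesis
    by (intro Lim_bounded[where M = 0]) auto
qed

text \<open>The form in which all estimates along a backward orbit arise: \<open>y\<close> is the image of \<open>x\<close> under
  \<open>n\<close> steps of the cocycle, which contract at rate \<open>\<mu>\<close> up to a factor of slow growth, and \<open>x\<close> is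
  bounded by the \<open>m\<close>-th power of a slowly growing quantity one step further in the past. Half of
  the contraction rate is spent on the growth.\<close>

lemma contraction_beats_growth:
  fixes a b \<delta> \<mu> :: real
  assumes y: "norm y \<le> b * exp (\<delta> * real n) * exp (- \<mu> * real n) * norm x"
    and x: "norm x \<le> a * (b * exp (\<delta> * real (Suc n))) ^ m"
    and "0 \<le> a" "0 \<le> b" "real (Suc m) * \<delta> \<le> \<mu> / 2"
  shows "norm y \<le> a * exp (real m * \<delta>) * b ^ Suc m * exp (- \<mu> / 2) ^ n"
proof -
  have "norm y \<le> b * exp (\<delta> * real n) * exp (- \<mu> * real n) * (a * (b * exp (\<delta> * real (Suc n))) ^ m)"
    using assms by (intro order_trans[OF y] mult_left_mono) auto
  also have "\<dots> = a * exp (real m * \<delta>) * b ^ Suc m * exp ((real (Suc m) * \<delta> - \<mu>) * real n)"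
    by (simp add: power_mult_distrib flip: exp_of_nat_mult exp_add)
      (simp add: algebra_simps flip: exp_add)
  also have "\<dots> \<le> a * exp (real m * \<delta>) * b ^ Suc m * exp ((- \<mu> / 2) * real n)"
  proof -
    have "(real (Suc m) * \<delta> - \<mu>) * real n \<le> (- \<mu> / 2) * real n"
      using assms(5) by (intro mult_right_mono) auto
    then show ?thesis using assms(3,4) by (intro mult_left_mono) auto
  qed
  also have "exp ((- \<mu> / 2) * real n) = exp (- \<mu> / 2) ^ n"
    by (metis exp_of_nat2_mult)
  finally show ?thesis .
qed

section \<open>Linear response\<close>

theorem theorem11:
  fixes M :: "'a measure" and \<sigma> :: "'a \<Rightarrow> 'a"
    and js :: "'s::banach \<Rightarrow>\<^sub>L 'w::banach" and jss :: "'ss::banach \<Rightarrow>\<^sub>L 's"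
    and \<psi> :: "'s \<Rightarrow>\<^sub>L 'k::real_normed_field" and \<psi>w :: "'w \<Rightarrow>\<^sub>L 'k"
    and I :: "real set"
    and Lw :: "'a \<Rightarrow> real \<Rightarrow> 'w \<Rightarrow>\<^sub>L 'w"
    and Ls :: "'a \<Rightarrow> real \<Rightarrow> 's \<Rightarrow>\<^sub>L 's"
    and Lss :: "'a \<Rightarrow> real \<Rightarrow> 'ss \<Rightarrow>\<^sub>L 'ss"
    and \<epsilon> :: "nat \<Rightarrow> real"
    and \<Omega>' :: "'a set" and C :: "'a \<Rightarrow> real"
    and h :: "'a \<Rightarrow> nat \<Rightarrow> 'ss"
    and Lhat :: "'a \<Rightarrow> 'ss \<Rightarrow>\<^sub>L 'w"
    and lam :: real
  assumes prob: "prob_space M"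
    and sigma: "mp_automorphism M \<sigma>" "ergodic M \<sigma>"
    and embeddings: "contractive_embedding js" "contractive_embedding jss"
    and psi_nonzero: "\<psi> \<noteq> 0"
    and psi_extension: "\<And>x. \<psi>w (js x) = \<psi> x"
    and interval: "is_interval I" "I \<subseteq> {-1<..<1}" "0 \<in> I"
    and L_s_w: "\<And>\<omega> e x. \<omega> \<in> space M \<Longrightarrow> e \<in> I \<Longrightarrow> Lw \<omega> e (js x) = js (Ls \<omega> e x)"
    and L_ss_s: "\<And>\<omega> e x. \<omega> \<in> space M \<Longrightarrow> e \<in> I \<Longrightarrow> Ls \<omega> e (jss x) = jss (Lss \<omega> e x)"
    and L_psi: "\<And>\<omega> e x. \<omega> \<in> space M \<Longrightarrow> e \<in> I \<Longrightarrow> \<psi>w (Lw \<omega> e x) = \<psi>w x"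
    and L_meas: "\<And>x. strongly_measurable M (\<lambda>\<omega>. Lw \<omega> 0 x)"
    and eps: "\<epsilon> 0 = 0" "\<And>k. k \<ge> 1 \<Longrightarrow> \<epsilon> k \<in> I - {0}" "\<epsilon> \<longlonglongrightarrow> 0"
    and Omega': "\<Omega>' \<in> sets M" "measure M \<Omega>' = 1" "\<sigma> -` \<Omega>' \<inter> space M = \<Omega>'"
    and C: "tempered M \<sigma> C"
    and h1: "\<And>\<omega> k. \<omega> \<in> \<Omega>' \<Longrightarrow>
      Lss \<omega> (\<epsilon> k) (h \<omega> k) = h (\<sigma> \<omega>) k \<and> \<psi> (jss (h \<omega> k)) = 1 \<and> norm (h \<omega> k) \<le> C \<omega>"
    and h1_meas: "strongly_measurable (restrict_space M \<Omega>') (\<lambda>\<omega>. h \<omega> 0)"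
    and h2_w: "\<And>\<omega> x n. \<omega> \<in> \<Omega>' \<Longrightarrow> n \<ge> 1 \<Longrightarrow>
      norm (cocycle \<sigma> (\<lambda>\<omega>. Lw \<omega> 0) n (zpow M \<sigma> (- int n) \<omega>) x) \<le> C \<omega> * norm x"
    and h2_s: "\<And>\<omega> x n. \<omega> \<in> \<Omega>' \<Longrightarrow> n \<ge> 1 \<Longrightarrow>
      norm (cocycle \<sigma> (\<lambda>\<omega>. Ls \<omega> 0) n (zpow M \<sigma> (- int n) \<omega>) x) \<le> C \<omega> * norm x"
    and h3_lam: "lam > 0"
    and h3_w: "\<And>\<omega> x n. \<omega> \<in> \<Omega>' \<Longrightarrow> n \<ge> 1 \<Longrightarrow> x \<in> Vw js jss \<psi> \<Longrightarrow>
      norm (cocycle \<sigma> (\<lambda>\<omega>. Lw \<omega> 0) n \<omega> x) \<le> C \<omega> * exp (- lam * real n) * norm x"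
    and h3_s: "\<And>\<omega> x n. \<omega> \<in> \<Omega>' \<Longrightarrow> n \<ge> 1 \<Longrightarrow> x \<in> Vs jss \<psi> \<Longrightarrow>
      norm (cocycle \<sigma> (\<lambda>\<omega>. Ls \<omega> 0) n \<omega> x) \<le> C \<omega> * exp (- lam * real n) * norm x"
    and h4_w: "\<And>\<omega> k x. \<omega> \<in> \<Omega>' \<Longrightarrow> k \<ge> 1 \<Longrightarrow>
      norm ((Lw \<omega> (\<epsilon> k) - Lw \<omega> 0) (js x)) \<le> C \<omega> * \<bar>\<epsilon> k\<bar> * norm x"
    and h4_s: "\<And>\<omega> k x. \<omega> \<in> \<Omega>' \<Longrightarrow> k \<ge> 1 \<Longrightarrow>
      norm ((Ls \<omega> (\<epsilon> k) - Ls \<omega> 0) (jss x)) \<le> C \<omega> * \<bar>\<epsilon> k\<bar> * norm x"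
    and h5_range: "\<And>\<omega> x. \<omega> \<in> \<Omega>' \<Longrightarrow> Lhat \<omega> x \<in> Vw js jss \<psi>"
    and h5: "\<And>\<omega> k x. \<omega> \<in> \<Omega>' \<Longrightarrow> k \<ge> 1 \<Longrightarrow>
      norm ((1 / \<epsilon> k) *\<^sub>R (Lw \<omega> (\<epsilon> k) - Lw \<omega> 0) (js (jss x)) - Lhat \<omega> x)
        \<le> C \<omega> * \<bar>\<epsilon> k\<bar> * norm x"
    and h5_meas: "\<And>x. strongly_measurable (restrict_space M \<Omega>') (\<lambda>\<omega>. Lhat \<omega> x)"
  shows "\<exists>hhat K r.
    strongly_measurable M hhat \<and> (\<forall>\<omega>\<in>space M. hhat \<omega> \<in> closure (Vw js jss \<psi>)) \<and>
    tempered M \<sigma> K \<and> r > 0 \<and>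
    (AE \<omega> in M. \<forall>k\<ge>1.
       norm ((1 / \<epsilon> k) *\<^sub>R (js (jss (h \<omega> k)) - js (jss (h \<omega> 0))) - hhat \<omega>)
         \<le> K \<omega> * \<bar>\<epsilon> k\<bar> powr r) \<and>
    (AE \<omega> in M.
       (\<lambda>n. cocycle \<sigma> (\<lambda>\<omega>. Lw \<omega> 0) n (zpow M \<sigma> (- int n) \<omega>)
              (Lhat (zpow M \<sigma> (- int (n + 1)) \<omega>) (h (zpow M \<sigma> (- int (n + 1)) \<omega>) 0)))
       sums hhat \<omega>)"
proof -
  interpret prob_space M by (rule prob)
  note aut = sigma(1)
  let ?P = "\<lambda>x. js (jss x)"
  \<comment> \<open>The largest power of \<open>B\<close> below is the fifth, and growth at rate \<open>5 * \<delta>\<close> must not exceed half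
    of the contraction rate.\<close>
  define \<delta> where "\<delta> = lam / 10"
  define q where "q = exp (- lam / 2)"
  define c where "c = exp (2 * \<delta>) / (1 - q)"
  have \<delta>: "\<delta> > 0" using h3_lam by (simp add: \<delta>_def)
  have q: "0 \<le> q" "q < 1" using h3_lam by (simp_all add: q_def)
  have c: "c \<ge> 0" using q by (simp add: c_def)

  have Omega'_space: "\<omega> \<in> space M" if "\<omega> \<in> \<Omega>'" for \<omega>
    using that sets.sets_into_space[OF Omega'(1)] by auto
  have AE_Omega': "AE \<omega> in M. \<omega> \<in> \<Omega>'"
    using Omega'(2) prob_eq_1[OF Omega'(1)] by simp
  obtain B G where G: "G \<in> sets M" "AE \<omega> in M. \<omega> \<in> G"
    and G_Omega': "\<And>\<omega>. \<omega> \<in> G \<Longrightarrow> \<omega> \<in> \<Omega>'"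
    and G_inv: "\<And>\<omega> n. \<omega> \<in> G \<Longrightarrow> zpow M \<sigma> n \<omega> \<in> G"
    and B: "tempered M \<sigma> B" "\<And>\<omega>. \<omega> \<in> G \<Longrightarrow> 1 \<le> B \<omega>" "\<And>\<omega>. \<omega> \<in> G \<Longrightarrow> C \<omega> \<le> B \<omega>"
    and B_growth: "\<And>\<omega> n. \<omega> \<in> G \<Longrightarrow> B (zpow M \<sigma> n \<omega>) \<le> B \<omega> * exp (\<delta> * \<bar>of_int n\<bar>)"
    by (rule tempered_envelope[OF aut C AE_Omega' \<delta>]) (rule that; assumption)
  have G_space: "\<omega> \<in> space M" if "\<omega> \<in> G" for \<omega>
    using Omega'_space G_Omega' that by blast

  have eps_I: "\<epsilon> k \<in> I" for k
    using eps interval(3) by (cases "k = 0") auto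
  have eps_le: "\<bar>\<epsilon> k\<bar> \<le> 1" for k
    using eps_I[of k] interval(2) by (auto simp: subset_eq)
  have jss_le: "norm (jss x) \<le> norm x" for x
    using embeddings(2) by (simp add: contractive_embedding_def)

  have Vw_Vs: "Vw js jss \<psi> = js ` Vs jss \<psi>"
    by (auto simp: Vw_def Vs_def)
  have Vw_zero: "0 \<in> Vw js jss \<psi>"
    unfolding Vw_def Vss_def by (rule image_eqI[where x = 0]) (auto simp: blinfun.zero_right)
  have Vw_add: "x + y \<in> Vw js jss \<psi>" if xy: "x \<in> Vw js jss \<psi>" "y \<in> Vw js jss \<psi>" for x y
  proof -
    obtain a b where "x = ?P a" "y = ?P b" "\<psi> (jss a) = 0" "\<psi> (jss b) = 0"
      using xy by (auto simp: Vw_def Vss_def)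
    then show ?thesis unfolding Vw_def Vss_def
      by (intro image_eqI[where x = "a + b"]) (auto simp: blinfun.add_right)
  qed
  have Vw_scale: "r *\<^sub>R x \<in> Vw js jss \<psi>" if x: "x \<in> Vw js jss \<psi>" for x r
  proof -
    obtain a where "x = ?P a" "\<psi> (jss a) = 0"
      using x by (auto simp: Vw_def Vss_def)
    then show ?thesis unfolding Vw_def Vss_def
      by (intro image_eqI[where x = "r *\<^sub>R a"]) (auto simp: blinfun.scaleR_right)
  qed
  have Vw_diff: "x - y \<in> Vw js jss \<psi>" if "x \<in> Vw js jss \<psi>" "y \<in> Vw js jss \<psi>" for x y
    using Vw_add[OF that(1) Vw_scale[OF that(2), of "-1"]] by simp

  have L_P: "Lw \<omega> e (?P x) = ?P (Lss \<omega> e x)" if "\<omega> \<in> space M" "e \<in> I" for \<omega> e x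
    using that by (simp add: L_s_w L_ss_s)
  have Lss_psi: "\<psi> (jss (Lss \<omega> e x)) = \<psi> (jss x)" if "\<omega> \<in> space M" "e \<in> I" for \<omega> e x
    using L_psi[OF that, of "?P x"] L_P[OF that, of x] by (simp add: psi_extension)
  have L_Vw: "Lw \<omega> e x \<in> Vw js jss \<psi>" if "\<omega> \<in> space M" "e \<in> I" "x \<in> Vw js jss \<psi>" for \<omega> e x
    using that by (auto simp: Vw_def Vss_def L_P Lss_psi)
  have pert_Vs: "(Ls \<omega> e - Ls \<omega> 0) (jss x) \<in> Vs jss \<psi>" if "\<omega> \<in> space M" "e \<in> I" for \<omega> e x
    unfolding Vs_def Vss_def using that interval(3)
    by (intro image_eqI[where x = "Lss \<omega> e x - Lss \<omega> 0 x"])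
      (auto simp: blinfun.diff_left blinfun.diff_right L_ss_s Lss_psi)

  let ?Lw = "\<lambda>\<omega>. Lw \<omega> 0" and ?Ls = "\<lambda>\<omega>. Ls \<omega> 0"
  have funpow_space: "(\<sigma> ^^ n) \<omega> \<in> space M" if "\<omega> \<in> space M" for \<omega> n
    using that by (induction n) (auto simp: mp_automorphism_inverse(1)[OF aut])
  have cocycle_js: "cocycle \<sigma> ?Lw n \<omega> (js x) = js (cocycle \<sigma> ?Ls n \<omega> x)" if "\<omega> \<in> space M" for n \<omega> x
    using that interval(3) by (induction n) (auto simp: L_s_w funpow_space)
  have cocycle_Vw: "cocycle \<sigma> ?Lw n \<omega> x \<in> Vw js jss \<psi>"
    if "\<omega> \<in> space M" "x \<in> Vw js jss \<psi>" for n \<omega> x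
    using that interval(3) by (induction n) (auto simp: L_Vw funpow_space)

  \<comment> \<open>\<open>Tw n \<omega>\<close> and \<open>Ts n \<omega>\<close> transport from the fibre over the \<open>n\<close>-th preimage of \<open>\<omega>\<close> to the fibre
    over \<open>\<omega>\<close>.\<close>
  define past where "past n = zpow M \<sigma> (- int n)" for n
  define Tw where "Tw n \<omega> = cocycle \<sigma> ?Lw n (past n \<omega>)" for n \<omega>
  define Ts where "Ts n \<omega> = cocycle \<sigma> ?Ls n (past n \<omega>)" for n \<omega>
  have past_G: "past n \<omega> \<in> G" if "\<omega> \<in> G" for n \<omega>
    unfolding past_def using G_inv[OF that] .
  have past_0: "past 0 \<omega> = \<omega>" for \<omega>
    by (simp add: past_def)
  have past_Suc: "\<sigma> (past (Suc n) \<omega>) = past n \<omega>" if "\<omega> \<in> G" for n \<omega>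
    using zpow_succ[OF aut G_space[OF that], of "- int (Suc n)"] by (simp add: past_def)
  have B_past: "B (past n \<omega>) \<le> B \<omega> * exp (\<delta> * real n)" if "\<omega> \<in> G" for n \<omega>
    using B_growth[OF that, of "- int n"] by (simp add: past_def)
  have C_B: "C \<omega> \<le> B \<omega>" "1 \<le> B \<omega>" "0 \<le> C \<omega>" if "\<omega> \<in> G" for \<omega>
    using B(2,3)[OF that] C G_space[OF that] by (auto simp: tempered_def intro: less_imp_le)

  \<comment> \<open>The decay hypotheses start at \<open>n = 1\<close>; the bound \<open>1 \<le> B \<omega>\<close> extends them to \<open>n = 0\<close>. The
    lemma is polymorphic because it serves both the weak and the strong space.\<close>
  have decay_cocycle:
    "norm (cocycle \<sigma> L n \<omega> x) \<le> B \<omega> * exp (- lam * real n) * norm x"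
    if "\<omega> \<in> G" "n \<ge> 1 \<Longrightarrow> norm (cocycle \<sigma> L n \<omega> x) \<le> C \<omega> * exp (- lam * real n) * norm x"
    for n \<omega> x and L :: "'a \<Rightarrow> 'v::real_normed_vector \<Rightarrow>\<^sub>L 'v"
  proof (cases "n = 0")
    case True
    have "1 * norm x \<le> B \<omega> * norm x"
      using C_B[OF that(1)] by (intro mult_right_mono) auto
    then show ?thesis using True by simp
  next
    case False
    with that(2) have "norm (cocycle \<sigma> L n \<omega> x) \<le> C \<omega> * exp (- lam * real n) * norm x" by simp
    also have "\<dots> \<le> B \<omega> * exp (- lam * real n) * norm x"
      using C_B[OF that(1)] by (intro mult_right_mono) auto
    finally show ?thesis .
  qed
  have Tw_decay: "norm (Tw n \<omega> x) \<le> B \<omega> * exp (\<delta> * real n) * exp (- lam * real n) * norm x"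
    if "\<omega> \<in> G" "x \<in> Vw js jss \<psi>" for n \<omega> x
  proof -
    have "norm (Tw n \<omega> x) \<le> B (past n \<omega>) * exp (- lam * real n) * norm x"
      unfolding Tw_def
      by (rule decay_cocycle[OF past_G[OF that(1)] h3_w[OF G_Omega'[OF past_G[OF that(1)]] _ that(2)]])
    also have "\<dots> \<le> B \<omega> * exp (\<delta> * real n) * exp (- lam * real n) * norm x"
      by (intro mult_right_mono B_past[OF that(1)]) auto
    finally show ?thesis .
  qed
  have Ts_decay: "norm (Ts n \<omega> x) \<le> B \<omega> * exp (\<delta> * real n) * exp (- lam * real n) * norm x"
    if "\<omega> \<in> G" "x \<in> Vs jss \<psi>" for n \<omega> x
  proof -
    have "norm (Ts n \<omega> x) \<le> B (past n \<omega>) * exp (- lam * real n) * norm x"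
      unfolding Ts_def
      by (rule decay_cocycle[OF past_G[OF that(1)] h3_s[OF G_Omega'[OF past_G[OF that(1)]] _ that(2)]])
    also have "\<dots> \<le> B \<omega> * exp (\<delta> * real n) * exp (- lam * real n) * norm x"
      by (intro mult_right_mono B_past[OF that(1)]) auto
    finally show ?thesis .
  qed
  have past_bound: "a * B (past (Suc n) \<omega>) ^ m \<le> a * (B \<omega> * exp (\<delta> * real (Suc n))) ^ m"
    if "\<omega> \<in> G" "a \<ge> 0" for n \<omega> m and a :: real
    using B_past[OF that(1), of "Suc n"] C_B(2)[OF past_G[OF that(1), of "Suc n"]] that(2)
    by (intro mult_left_mono power_mono) auto
  have CB_mono: "C \<omega> * x * y \<le> x * B \<omega> * z" if "\<omega> \<in> G" "y \<le> z" "0 \<le> x" "0 \<le> y"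
    for \<omega> and x y z :: real
  proof -
    have "x * (C \<omega> * y) \<le> x * (B \<omega> * z)"
      using that C_B[OF that(1)] by (intro mult_left_mono mult_mono) auto
    then show ?thesis by (simp add: mult_ac)
  qed
  have h_le: "norm (h \<omega> k) \<le> B \<omega>" if "\<omega> \<in> G" for \<omega> k
    using h1[OF G_Omega'[OF that]] C_B[OF that] by (meson order_trans)

  \<comment> \<open>The remote past drops out of the telescoped equivariance relation because \<open>h k - h 0\<close> has norm
    at most \<open>2 * B\<close>, which grows more slowly than the transport contracts.\<close>
  have strong_stability: "norm (jss (h \<omega> k - h \<omega> 0)) \<le> c * \<bar>\<epsilon> k\<bar> * B \<omega> ^ 3"
    and strong_sums: "(\<lambda>n. Ts n \<omega> ((Ls (past (Suc n) \<omega>) (\<epsilon> k) - Ls (past (Suc n) \<omega>) 0)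
      (jss (h (past (Suc n) \<omega>) k)))) sums jss (h \<omega> k - h \<omega> 0)"
    if \<omega>: "\<omega> \<in> G" and k: "k \<ge> 1" for \<omega> k
  proof -
    define u where "u n = (Ls (past (Suc n) \<omega>) (\<epsilon> k) - Ls (past (Suc n) \<omega>) 0)
      (jss (h (past (Suc n) \<omega>) k))" for n
    define d where "d n = jss (h (past n \<omega>) k - h (past n \<omega>) 0)" for n
    have d_Vs: "d n \<in> Vs jss \<psi>" for n
      unfolding d_def Vs_def Vss_def using h1[OF G_Omega'[OF past_G[OF \<omega>]]]
      by (intro imageI) (auto simp: blinfun.diff_right)
    have d_step: "d n = Ls (past (Suc n) \<omega>) 0 (d (Suc n)) + u n" for n
    proof -
      let ?\<omega> = "past (Suc n) \<omega>"
      have \<omega>': "?\<omega> \<in> \<Omega>'" "?\<omega> \<in> space M"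
        using past_G[OF \<omega>] G_Omega' G_space by blast+
      have "h (past n \<omega>) j = Lss ?\<omega> (\<epsilon> j) (h ?\<omega> j)" for j
        using h1[OF \<omega>'(1), of j] past_Suc[OF \<omega>] by simp
      then have "jss (h (past n \<omega>) j) = Ls ?\<omega> (\<epsilon> j) (jss (h ?\<omega> j))" for j
        using L_ss_s[OF \<omega>'(2) eps_I] by simp
      then show ?thesis
        by (simp add: d_def u_def eps(1) blinfun.diff_left blinfun.diff_right)
    qed
    have "norm (d n) \<le> 2 * B (past n \<omega>)" for n
      unfolding d_def
      using jss_le[of "h (past n \<omega>) k - h (past n \<omega>) 0"]
        norm_triangle_ineq4[of "h (past n \<omega>) k" "h (past n \<omega>) 0"]
        h_le[OF past_G[OF \<omega>], of n k] h_le[OF past_G[OF \<omega>], of n 0] by linarith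
    then have d_le: "norm (d n) \<le> 2 * (B \<omega> * exp (\<delta> * real (Suc n))) ^ 1" for n
    proof -
      have "B \<omega> * exp (\<delta> * real n) \<le> B \<omega> * exp (\<delta> * real (Suc n))"
        using C_B[OF \<omega>] \<delta> by (intro mult_left_mono) auto
      then show ?thesis
        using \<open>norm (d n) \<le> 2 * B (past n \<omega>)\<close> B_past[OF \<omega>, of n] by simp
    qed
    have "norm (Ts n \<omega> (d n)) \<le> 2 * exp (real 1 * \<delta>) * B \<omega> ^ Suc 1 * q ^ n" for n
      unfolding q_def using C_B[OF \<omega>] h3_lam
      by (intro contraction_beats_growth[OF Ts_decay[OF \<omega> d_Vs] d_le]) (auto simp: \<delta>_def)
    moreover have "(\<lambda>n. 2 * exp (real 1 * \<delta>) * B \<omega> ^ Suc 1 * q ^ n) \<longlonglongrightarrow> 0"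
      using q by (intro tendsto_mult_right_zero LIMSEQ_realpow_zero) auto
    ultimately have lim: "(\<lambda>n. Ts n \<omega> (d n)) \<longlonglongrightarrow> 0"
      by (rule Lim_null_comparison[OF always_eventually[OF allI]])
    have Ts_step: "Ts (Suc n) \<omega> = Ts n \<omega> o\<^sub>L Ls (past (Suc n) \<omega>) 0" for n
      unfolding Ts_def by (simp only: cocycle_Suc_shift past_Suc[OF \<omega>])
    have sums: "(\<lambda>n. Ts n \<omega> (u n)) sums d 0"
      by (rule telescoping_sums[OF _ Ts_step d_step lim]) (simp add: Ts_def)
    then show "(\<lambda>n. Ts n \<omega> ((Ls (past (Suc n) \<omega>) (\<epsilon> k) - Ls (past (Suc n) \<omega>) 0)
      (jss (h (past (Suc n) \<omega>) k)))) sums jss (h \<omega> k - h \<omega> 0)"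
      by (simp add: u_def d_def past_0)
    have u_le: "norm (u n) \<le> \<bar>\<epsilon> k\<bar> * (B \<omega> * exp (\<delta> * real (Suc n))) ^ 2" for n
    proof -
      let ?\<omega> = "past (Suc n) \<omega>"
      have "norm (u n) \<le> C ?\<omega> * \<bar>\<epsilon> k\<bar> * norm (h ?\<omega> k)"
        unfolding u_def by (rule h4_s[OF G_Omega'[OF past_G[OF \<omega>]] k])
      also have "\<dots> \<le> \<bar>\<epsilon> k\<bar> * B ?\<omega> * B ?\<omega>"
        by (rule CB_mono[OF past_G[OF \<omega>] h_le[OF past_G[OF \<omega>]]]) auto
      also have "\<dots> = \<bar>\<epsilon> k\<bar> * B ?\<omega> ^ 2"
        by (simp add: power2_eq_square)
      also have "\<dots> \<le> \<bar>\<epsilon> k\<bar> * (B \<omega> * exp (\<delta> * real (Suc n))) ^ 2"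
        by (rule past_bound[OF \<omega>]) simp
      finally show ?thesis .
    qed
    have u_Vs: "u n \<in> Vs jss \<psi>" for n
      unfolding u_def by (rule pert_Vs[OF G_space[OF past_G[OF \<omega>]] eps_I])
    have "norm (Ts n \<omega> (u n)) \<le> \<bar>\<epsilon> k\<bar> * exp (real 2 * \<delta>) * B \<omega> ^ Suc 2 * q ^ n" for n
      unfolding q_def using C_B[OF \<omega>] h3_lam
      by (intro contraction_beats_growth[OF Ts_decay[OF \<omega> u_Vs] u_le]) (auto simp: \<delta>_def)
    from norm_sums_geometric[OF sums this q]
    have "norm (d 0) \<le> \<bar>\<epsilon> k\<bar> * exp (real 2 * \<delta>) * B \<omega> ^ Suc 2 / (1 - q)" .
    then show "norm (jss (h \<omega> k - h \<omega> 0)) \<le> c * \<bar>\<epsilon> k\<bar> * B \<omega> ^ 3"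
      by (simp add: d_def past_0 c_def mult_ac eval_nat_numeral)
  qed

  define g where "g n \<omega> = Tw n \<omega> (Lhat (past (Suc n) \<omega>) (h (past (Suc n) \<omega>) 0))" for n \<omega>
  define hhat where "hhat \<omega> = (if \<omega> \<in> G then (\<Sum>n. g n \<omega>) else 0)" for \<omega>
  \<comment> \<open>No bound on the operator norm of \<open>Lhat \<omega>\<close> is given: it comes from comparison with the
    difference quotient at \<open>k = 1\<close>, using \<open>\<bar>\<epsilon> 1\<bar> \<le> 1\<close>.\<close>
  have Lhat_le: "norm (Lhat \<omega> (h \<omega> 0)) \<le> 2 * B \<omega> ^ 2" if \<omega>: "\<omega> \<in> G" for \<omega>
  proof -
    let ?y = "(Lw \<omega> (\<epsilon> 1) - Lw \<omega> 0) (?P (h \<omega> 0))"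
    have e: "\<bar>\<epsilon> 1\<bar> > 0" using eps(2)[of 1] by simp
    have CB: "C \<omega> * norm (h \<omega> 0) \<le> B \<omega> ^ 2"
      unfolding power2_eq_square using C_B[OF \<omega>] h_le[OF \<omega>] by (intro mult_mono) auto
    have "norm ?y \<le> C \<omega> * \<bar>\<epsilon> 1\<bar> * norm (h \<omega> 0)"
      using C_B[OF \<omega>] by (intro order_trans[OF h4_w[OF G_Omega'[OF \<omega>]]] mult_left_mono jss_le) auto
    then have "norm ((1 / \<epsilon> 1) *\<^sub>R ?y) \<le> C \<omega> * norm (h \<omega> 0)"
      using e by (simp add: divide_simps mult_ac)
    moreover have "norm ((1 / \<epsilon> 1) *\<^sub>R ?y - Lhat \<omega> (h \<omega> 0)) \<le> C \<omega> * norm (h \<omega> 0)"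
    proof -
      have "norm ((1 / \<epsilon> 1) *\<^sub>R ?y - Lhat \<omega> (h \<omega> 0)) \<le> \<bar>\<epsilon> 1\<bar> * (C \<omega> * norm (h \<omega> 0))"
        using h5[OF G_Omega'[OF \<omega>], of 1 "h \<omega> 0"] by (simp add: mult_ac)
      also have "\<dots> \<le> 1 * (C \<omega> * norm (h \<omega> 0))"
        using eps_le[of 1] C_B[OF \<omega>] by (intro mult_right_mono) auto
      finally show ?thesis by simp
    qed
    ultimately show ?thesis
      using CB norm_triangle_sub[of "Lhat \<omega> (h \<omega> 0)" "(1 / \<epsilon> 1) *\<^sub>R ?y"]
      by (simp add: norm_minus_commute)
  qed
  have Lhat_Vw: "Lhat (past n \<omega>) x \<in> Vw js jss \<psi>" if "\<omega> \<in> G" for n \<omega> x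
    by (rule h5_range[OF G_Omega'[OF past_G[OF that]]])
  have g_sums: "(\<lambda>n. g n \<omega>) sums hhat \<omega>" if \<omega>: "\<omega> \<in> G" for \<omega>
  proof -
    have "norm (g n \<omega>) \<le> 2 * exp (real 2 * \<delta>) * B \<omega> ^ Suc 2 * q ^ n" for n
      unfolding g_def q_def using C_B[OF \<omega>] h3_lam
      by (intro contraction_beats_growth[OF Tw_decay[OF \<omega> Lhat_Vw[OF \<omega>]]
            order_trans[OF Lhat_le[OF past_G[OF \<omega>]] past_bound[OF \<omega>]]])
        (auto simp: \<delta>_def)
    moreover have "summable (\<lambda>n. 2 * exp (real 2 * \<delta>) * B \<omega> ^ Suc 2 * q ^ n)"
      by (rule summable_mult[OF summable_geometric]) (use q in simp)
    ultimately have "summable (\<lambda>n. g n \<omega>)"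
      by (rule summable_comparison_test'[where N = 0, rotated])
    then show ?thesis using \<omega> by (simp add: hhat_def summable_sums)
  qed

  define a where "a = (c + 1) * exp (4 * \<delta>) / (1 - q)"
  have a: "a > 0" using c q by (simp add: a_def)
  have response: "norm ((1 / \<epsilon> k) *\<^sub>R (?P (h \<omega> k) - ?P (h \<omega> 0)) - hhat \<omega>)
      \<le> a * B \<omega> ^ 5 * \<bar>\<epsilon> k\<bar>" if \<omega>: "\<omega> \<in> G" and k: "k \<ge> 1" for \<omega> k
  proof -
    have e: "\<epsilon> k \<noteq> 0" using eps(2)[OF k] by simp
    define v where "v n = (1 / \<epsilon> k) *\<^sub>R (Lw (past (Suc n) \<omega>) (\<epsilon> k) - Lw (past (Suc n) \<omega>) 0)
      (?P (h (past (Suc n) \<omega>) k))" for n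
    define w where "w n = v n - Lhat (past (Suc n) \<omega>) (h (past (Suc n) \<omega>) 0)" for n
    have v_js: "v n = (1 / \<epsilon> k) *\<^sub>R js ((Ls (past (Suc n) \<omega>) (\<epsilon> k) - Ls (past (Suc n) \<omega>) 0)
      (jss (h (past (Suc n) \<omega>) k)))" for n
      using L_s_w[OF G_space[OF past_G[OF \<omega>]]] eps_I interval(3)
      by (simp add: v_def blinfun.diff_left blinfun.diff_right)
    \<comment> \<open>The strong telescoped series, pushed to the weak space and divided by \<open>\<epsilon> k\<close>.\<close>
    have "(\<lambda>n. (1 / \<epsilon> k) *\<^sub>R js (Ts n \<omega> ((Ls (past (Suc n) \<omega>) (\<epsilon> k) - Ls (past (Suc n) \<omega>) 0)
      (jss (h (past (Suc n) \<omega>) k))))) sums ((1 / \<epsilon> k) *\<^sub>R js (jss (h \<omega> k - h \<omega> 0)))"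
      by (intro sums_scaleR_right bounded_linear.sums[OF blinfun.bounded_linear_right]
          strong_sums[OF \<omega> k])
    then have "(\<lambda>n. Tw n \<omega> (v n)) sums ((1 / \<epsilon> k) *\<^sub>R (?P (h \<omega> k) - ?P (h \<omega> 0)))"
      by (simp add: v_js Tw_def Ts_def blinfun.scaleR_right blinfun.diff_right
          cocycle_js[OF G_space[OF past_G[OF \<omega>]]])
    from sums_diff[OF this g_sums[OF \<omega>]]
    have sums: "(\<lambda>n. Tw n \<omega> (w n)) sums ((1 / \<epsilon> k) *\<^sub>R (?P (h \<omega> k) - ?P (h \<omega> 0)) - hhat \<omega>)"
      by (simp add: w_def g_def blinfun.diff_right)
    have w_Vw: "w n \<in> Vw js jss \<psi>" for n
      unfolding w_def v_js
      by (intro Vw_diff Vw_scale Lhat_Vw[OF \<omega>])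
        (auto simp: Vw_Vs intro!: pert_Vs[OF G_space[OF past_G[OF \<omega>]] eps_I])
    have w_le: "norm (w n) \<le> (c + 1) * \<bar>\<epsilon> k\<bar> * (B \<omega> * exp (\<delta> * real (Suc n))) ^ 4" for n
    proof -
      let ?\<omega> = "past (Suc n) \<omega>"
      let ?D = "Lw ?\<omega> (\<epsilon> k) - Lw ?\<omega> 0"
      have \<omega>': "?\<omega> \<in> G" by (rule past_G[OF \<omega>])
      have B1: "1 \<le> B ?\<omega>" using C_B[OF \<omega>'] by simp
      \<comment> \<open>The difference quotient, not \<open>Lhat\<close>, must act on \<open>h k - h 0\<close>: this difference is small only
        in the strong norm, while \<open>Lhat\<close> is controlled only by the norm of the smallest space.\<close>
      have split: "w n = (1 / \<epsilon> k) *\<^sub>R ?D (js (jss (h ?\<omega> k - h ?\<omega> 0)))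
          + ((1 / \<epsilon> k) *\<^sub>R ?D (?P (h ?\<omega> 0)) - Lhat ?\<omega> (h ?\<omega> 0))"
        by (simp add: w_def v_def blinfun.diff_right scaleR_diff_right)
      have "norm (?D (js (jss (h ?\<omega> k - h ?\<omega> 0)))) \<le> C ?\<omega> * \<bar>\<epsilon> k\<bar> * norm (jss (h ?\<omega> k - h ?\<omega> 0))"
        by (rule h4_w[OF G_Omega'[OF \<omega>'] k])
      also have "\<dots> \<le> \<bar>\<epsilon> k\<bar> * B ?\<omega> * (c * \<bar>\<epsilon> k\<bar> * B ?\<omega> ^ 3)"
        by (rule CB_mono[OF \<omega>' strong_stability[OF \<omega>' k]]) auto
      also have "\<dots> = \<bar>\<epsilon> k\<bar> * (c * \<bar>\<epsilon> k\<bar> * B ?\<omega> ^ 4)"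
        by (simp add: eval_nat_numeral)
      finally have first: "norm ((1 / \<epsilon> k) *\<^sub>R ?D (js (jss (h ?\<omega> k - h ?\<omega> 0)))) \<le> c * \<bar>\<epsilon> k\<bar> * B ?\<omega> ^ 4"
        using e by (simp add: pos_divide_le_eq mult_ac)
      have "norm ((1 / \<epsilon> k) *\<^sub>R ?D (?P (h ?\<omega> 0)) - Lhat ?\<omega> (h ?\<omega> 0))
          \<le> C ?\<omega> * \<bar>\<epsilon> k\<bar> * norm (h ?\<omega> 0)"
        by (rule h5[OF G_Omega'[OF \<omega>'] k])
      also have "\<dots> \<le> \<bar>\<epsilon> k\<bar> * B ?\<omega> * B ?\<omega>"
        by (rule CB_mono[OF \<omega>' h_le[OF \<omega>']]) auto
      also have "\<dots> = \<bar>\<epsilon> k\<bar> * B ?\<omega> ^ 2"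
        by (simp add: power2_eq_square)
      also have "\<dots> \<le> \<bar>\<epsilon> k\<bar> * B ?\<omega> ^ 4"
        using B1 by (intro mult_left_mono power_increasing) auto
      finally have "norm (w n) \<le> c * \<bar>\<epsilon> k\<bar> * B ?\<omega> ^ 4 + \<bar>\<epsilon> k\<bar> * B ?\<omega> ^ 4"
        unfolding split using first by (intro norm_triangle_le add_mono)
      also have "\<dots> = (c + 1) * \<bar>\<epsilon> k\<bar> * B ?\<omega> ^ 4"
        by (simp add: algebra_simps)
      also have "\<dots> \<le> (c + 1) * \<bar>\<epsilon> k\<bar> * (B \<omega> * exp (\<delta> * real (Suc n))) ^ 4"
        using c by (intro past_bound[OF \<omega>]) auto
      finally show ?thesis .
    qed
    have "norm (Tw n \<omega> (w n)) \<le> (c + 1) * \<bar>\<epsilon> k\<bar> * exp (real 4 * \<delta>) * B \<omega> ^ Suc 4 * q ^ n" for n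
      unfolding q_def using C_B[OF \<omega>] h3_lam c
      by (intro contraction_beats_growth[OF Tw_decay[OF \<omega> w_Vw] w_le]) (auto simp: \<delta>_def)
    from norm_sums_geometric[OF sums this q] show ?thesis
      by (simp add: a_def mult_ac eval_nat_numeral)
  qed

  have hhat_meas: "strongly_measurable M hhat"
  proof -
    let ?MG = "restrict_space M G" and ?MO = "restrict_space M \<Omega>'"
    have space_MG: "space ?MG = G" and space_MO: "space ?MO = \<Omega>'"
      using G_space Omega'_space by (auto simp: space_restrict_space)
    have past_meas: "past n \<in> measurable ?MG M" for n
      unfolding past_def by (rule measurable_restrict_space1[OF zpow_measurable[OF aut]])
    then have past_meas': "past n \<in> measurable ?MG ?MO" for n
      by (intro measurable_restrict_space2) (auto simp: space_MG G_Omega' past_G)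
    have \<sigma>: "\<sigma> \<in> measurable M M"
      using aut by (simp add: mp_automorphism_def)
    have "strongly_measurable ?MO (\<lambda>\<omega>. Lhat \<omega> (h \<omega> 0))"
      by (rule strongly_measurable_blinfun_apply[OF h5_meas h1_meas])
    then have Lhat_meas: "strongly_measurable ?MG (\<lambda>\<omega>. Lhat (past n \<omega>) (h (past n \<omega>) 0))" for n
      using past_meas'
      by (rule strongly_measurable_compose[where f = "\<lambda>\<omega>. Lhat \<omega> (h \<omega> 0)" and g = "past n"])
    have Tw_meas: "strongly_measurable ?MG (\<lambda>\<omega>. Tw n \<omega> x)" for n x
      unfolding Tw_def using strongly_measurable_cocycle[OF \<sigma> L_meas] past_meas
      by (rule strongly_measurable_compose
          [where f = "\<lambda>\<omega>. cocycle \<sigma> ?Lw n \<omega> x" and g = "past n"])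
    have "strongly_measurable ?MG (g n)" for n
      unfolding g_def by (rule strongly_measurable_blinfun_apply[OF Tw_meas Lhat_meas])
    then have "strongly_measurable ?MG (\<lambda>\<omega>. \<Sum>n<N. g n \<omega>)" for N
      by (rule strongly_measurable_sum)
    then have "strongly_measurable ?MG (\<lambda>\<omega>. \<Sum>n. g n \<omega>)"
      by (rule strongly_measurable_LIMSEQ)
        (use g_sums in \<open>auto simp: space_MG hhat_def sums_def\<close>)
    then show ?thesis
      unfolding hhat_def by (rule strongly_measurable_extend_zero[OF G(1)])
  qed
  have hhat_closure: "hhat \<omega> \<in> closure (Vw js jss \<psi>)" for \<omega>
  proof (cases "\<omega> \<in> G")
    case True
    have "(\<Sum>n<N. g n \<omega>) \<in> Vw js jss \<psi>" for N
    proof (induction N)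
      case (Suc N)
      have "g N \<omega> \<in> Vw js jss \<psi>"
        unfolding g_def Tw_def by (rule cocycle_Vw[OF G_space[OF past_G[OF True]] Lhat_Vw[OF True]])
      with Suc show ?case by (simp add: Vw_add)
    qed (simp add: Vw_zero)
    then show ?thesis
      using g_sums[OF True] unfolding sums_def closure_sequential
      by (intro exI[of _ "\<lambda>N. \<Sum>n<N. g n \<omega>"]) simp
  next
    case False
    then show ?thesis
      using Vw_zero closure_subset by (auto simp: hhat_def)
  qed
  have K: "tempered M \<sigma> (\<lambda>\<omega>. a * B \<omega> ^ 5)"
    by (rule tempered_scale_power[OF B(1) a aut])
  have "AE \<omega> in M. \<forall>k\<ge>1. norm ((1 / \<epsilon> k) *\<^sub>R (?P (h \<omega> k) - ?P (h \<omega> 0)) - hhat \<omega>)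
      \<le> a * B \<omega> ^ 5 * \<bar>\<epsilon> k\<bar> powr 1"
    using G(2) by eventually_elim (use response in auto)
  moreover have "AE \<omega> in M.
       (\<lambda>n. cocycle \<sigma> (\<lambda>\<omega>. Lw \<omega> 0) n (zpow M \<sigma> (- int n) \<omega>)
              (Lhat (zpow M \<sigma> (- int (n + 1)) \<omega>) (h (zpow M \<sigma> (- int (n + 1)) \<omega>) 0)))
       sums hhat \<omega>"
    using G(2) by eventually_elim (use g_sums in \<open>simp add: g_def Tw_def past_def\<close>)
  ultimately show ?thesis
    using hhat_meas hhat_closure K
    by (intro exI[of _ hhat] exI[of _ "\<lambda>\<omega>. a * B \<omega> ^ 5"] exI[of _ 1]) auto
qed

end
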